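(* Let $d \ge 1$, $r \ge 2$, $t \ge 2$ be integers and let $\vec{F}$ be a non-$2$-coherent $r$-direction-vector in $\mathbb{R}^d$. Then there exists a constant $\Lambda_r > 0$ (depending only on $r$) such that $z_d^{\vec{F}}(\vec{n}; t) \le \Lambda_r \cdot g_t(\vec{n})$ holds for every $r$-tuple $\vec{n}=(n_1,\dots,n_r)$ of positive integers.
   Context: An (axis-parallel) box in $\mathbb{R}^d$ is a set $[a_1,b_1]\times\cdots\times[a_d,b_d]$ with real $a_i \le b_i$ (degenerate intervals allowed). Its direction set is $\{i : a_i < b_i\}$. An $r$-direction-vector in $\mathbb{R}^d$ is an $r$-tuple $\vec{F}=(F_1,\dots,F_r)$ of subsets of $\{1,\dots,d\}$. An $r$-tuple $(\mathcal{B}_1,\dots,\mathcal{B}_r)$ of multisets of boxes is an $\vec{F}$-family if every box in $\mathcal{B}_j$ has direction set exactly $F_j$. Its intersection hypergraph has vertices the elements of $\mathcal{B}_1\cup\dots\cup\mathcal{B}_r$, and $\{\mathbf{b}_1,\dots,\mathbf{b}_r\}$ with $\mathbf{b}_j\in\mathcal{B}_j$ is a hyperedge iff $\mathbf{b}_1\cap\dots\cap\mathbf{b}_r\neq\varnothing$. It contains $K^{(r)}_{t,\dots,t}$ if there are $t$-element subsets $S_j\subseteq\mathcal{B}_j$ such that every transversal choice is a hyperedge. $z_d^{\vec{F}}(n_1,\dots,n_r;t)$ is the maximum number of hyperedges of a $K^{(r)}_{t,\dots,t}$-free intersection hypergraph of an $\vec{F}$-family with $|\mathcal{B}_j|=n_j$.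 $\vec{F}$ is non-$2$-coherent if $\bigl|\bigcap_{j\neq k} F_j\bigr|\le 1$ for every $k\in\{1,\dots,r\}$. For positive integers $n_1,\dots,n_r$, $g_t(n_1,\dots,n_r) = t\, n_1\cdots n_r\bigl(\frac{1}{n_1}+\dots+\frac{1}{n_r}\bigr)$. *)

theory Defs
  imports Complex_Main "HOL-Library.Multiset" "HOL-Library.FuncSet"
begin

text \<open>
  The dimension \<open>d\<close> is quantified inside the main statement (the constant must not depend on it),
  so points of \<open>d\<close>-dimensional space are functions on \<open>{1..d}\<close> that are \<open>undefined\<close> elsewhere.
\<close>

type_synonym point = "nat \<Rightarrow> real"

definition is_box :: "nat \<Rightarrow> nat set \<Rightarrow> point set \<Rightarrow> bool" where
  \<comment> \<open>\<open>X\<close> is a box whose direction set is exactly \<open>D\<close>\<close>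
  "is_box d D X \<longleftrightarrow>
     (\<exists>a b :: nat \<Rightarrow> real.
        (\<forall>i\<in>{1..d}. a i \<le> b i) \<and>
        X = (\<Pi>\<^sub>E i\<in>{1..d}. {a i..b i}) \<and>
        D = {i \<in> {1..d}. a i < b i})"

definition direction_vector :: "nat \<Rightarrow> nat \<Rightarrow> (nat \<Rightarrow> nat set) \<Rightarrow> bool" where
  "direction_vector d r F \<longleftrightarrow> (\<forall>j\<in>{1..r}. F j \<subseteq> {1..d})"

definition non_2_coherent :: "nat \<Rightarrow> (nat \<Rightarrow> nat set) \<Rightarrow> bool" where
  "non_2_coherent r F \<longleftrightarrow> (\<forall>k\<in>{1..r}. card (\<Inter>j\<in>{1..r} - {k}. F j) \<le> 1)"

definition F_family ::
  "nat \<Rightarrow> nat \<Rightarrow> (nat \<Rightarrow> nat set) \<Rightarrow> (nat \<Rightarrow> point set multiset) \<Rightarrow> bool" where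
  "F_family d r F \<B> \<longleftrightarrow> (\<forall>j\<in>{1..r}. \<forall>X\<in>#\<B> j. is_box d (F j) X)"

text \<open>
  A vertex \<open>(j, X, c)\<close> is the \<open>c\<close>-th copy of the box \<open>X\<close> in the multiset \<open>\<B> j\<close>. Thus repeated boxes
  are different vertices, and so are equal boxes from different \<open>\<B> j\<close>.
\<close>

type_synonym vertex = "nat \<times> point set \<times> nat"

definition vertices :: "(nat \<Rightarrow> point set multiset) \<Rightarrow> nat \<Rightarrow> vertex set" where
  "vertices \<B> j = {(j, X, c) | X c. c < count (\<B> j) X}"

definition box_of :: "vertex \<Rightarrow> point set" where
  "box_of v = fst (snd v)"

definition hyperedges :: "nat \<Rightarrow> (nat \<Rightarrow> point set multiset) \<Rightarrow> vertex set set" where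
  "hyperedges r \<B> =
     {v ` {1..r} | v. (\<forall>j\<in>{1..r}. v j \<in> vertices \<B> j) \<and> (\<Inter>j\<in>{1..r}. box_of (v j)) \<noteq> {}}"

definition contains_K :: "nat \<Rightarrow> nat \<Rightarrow> (nat \<Rightarrow> point set multiset) \<Rightarrow> bool" where
  "contains_K r t \<B> \<longleftrightarrow>
     (\<exists>S. (\<forall>j\<in>{1..r}. S j \<subseteq> vertices \<B> j \<and> card (S j) = t) \<and>
          (\<forall>v. (\<forall>j\<in>{1..r}. v j \<in> S j) \<longrightarrow> v ` {1..r} \<in> hyperedges r \<B>))"

text \<open>
  For \<open>d \<ge> 1\<close>, \<open>r \<ge> 2\<close>, \<open>t \<ge> 1\<close> and a direction vector \<open>F\<close>, the set below is finite (there are at most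
  \<open>n 1 * \<dots> * n r\<close> hyperedges) and nonempty (move the boxes of \<open>\<B> 1\<close> away from all others), so the
  maximum is attained.
\<close>

definition zar ::
  "nat \<Rightarrow> nat \<Rightarrow> (nat \<Rightarrow> nat set) \<Rightarrow> (nat \<Rightarrow> nat) \<Rightarrow> nat \<Rightarrow> nat" where
  "zar d r F n t =
     Max {card (hyperedges r \<B>) | \<B>.
            F_family d r F \<B> \<and> (\<forall>j\<in>{1..r}. size (\<B> j) = n j) \<and> \<not> contains_K r t \<B>}"

definition g_fun :: "nat \<Rightarrow> nat \<Rightarrow> (nat \<Rightarrow> nat) \<Rightarrow> real" where
  "g_fun r t n = real t * (\<Prod>j\<in>{1..r}. real (n j)) * (\<Sum>j\<in>{1..r}. 1 / real (n j))"

end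

theory Submission
  imports Defs
begin

text \<open>
  Boxes meet iff their intervals meet in every coordinate. After splitting by the coordinates that
  force equalities, non-2-coherence leaves at most one relevant coordinate per class, in which that
  class consists of points and every other class of intervals.

  For an edge \<open>v\<close>, choose successively in each class \<open>j\<close> the first \<open>r * t\<close> elements from \<open>v j\<close> on that are
  compatible with the later members of \<open>v\<close> and with the segments spanned by the earlier choices. Either
  there are too few of them, or at least \<open>t\<close> chosen elements have an end inside one of the segments, or
  else at least \<open>t\<close> chosen elements per class survive and form a complete \<open>r\<close>-partite hypergraph. In
  the first two cases \<open>v\<close> can be charged to \<open>(r - 1)\<close>-tuples of elements so that each tuple receives a
  total weight of \<open>O(t)\<close>.
\<close>

section \<open>Interval incidences on positions\<close>

lemma card_le_fibres:
  assumes "finite A" "finite B" "f ` A \<subseteq> B" "\<And>y. y \<in> B \<Longrightarrow> card {x \<in> A. f x = y} \<le> c"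
  shows "card A \<le> c * card B"
proof -
  have "card A = card (\<Union>y\<in>B. {x \<in> A. f x = y})"
    using assms(3) by (intro arg_cong[where f = card]) auto
  also have "\<dots> \<le> (\<Sum>y\<in>B. card {x \<in> A. f x = y})"
    by (rule card_UN_le[OF assms(2)])
  also have "\<dots> \<le> (\<Sum>y\<in>B. c)"
    by (rule sum_mono) (use assms(4) in auto)
  finally show ?thesis by (simp add: mult.commute)
qed

text \<open>The least \<open>m\<close> in \<open>A\<close> with at least \<open>M\<close> elements
  of \<open>A\<close> up to it works: the elements below \<open>m\<close> form the initial segment
  of its predecessor in \<open>A\<close>, which has fewer than \<open>M\<close>.\<close>

lemma ex_initial_segment_card:
  fixes A :: "nat set"
  assumes "finite A" "1 \<le> M" "M \<le> card A"
  shows "\<exists>m\<in>A. card (A \<inter> {..m}) = M"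
proof -
  let ?B = "{m \<in> A. M \<le> card (A \<inter> {..m})}"
  have ne: "A \<noteq> {}" using assms by auto
  have "A \<inter> {..Max A} = A" using assms(1) by auto
  then have "Max A \<in> ?B" using assms ne by auto
  moreover have fB: "finite ?B" using assms(1) by auto
  ultimately have mB: "Min ?B \<in> ?B" using Min_in by blast
  define m where "m = Min ?B"
  have less: "card (A \<inter> {..<m}) < M"
  proof (cases "A \<inter> {..<m} = {}")
    case False
    define m' where "m' = Max (A \<inter> {..<m})"
    have m': "m' \<in> A" "m' < m" using Max_in[OF _ False] assms(1) by (auto simp: m'_def)
    have "A \<inter> {..m'} = A \<inter> {..<m}"
      using m' assms(1) by (auto simp: m'_def)
    moreover have "m' \<notin> ?B" using m'(2) Min_le[OF fB] by (force simp: m_def)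
    ultimately show ?thesis using m' by auto
  qed (use assms in auto)
  have "A \<inter> {..m} = insert m (A \<inter> {..<m})" using mB by (auto simp: m_def)
  then have "card (A \<inter> {..m}) \<le> Suc (card (A \<inter> {..<m}))" using assms(1) by simp
  then show ?thesis using less mB by (intro bexI[of _ m]) (auto simp: m_def)
qed

text \<open>
  The elements of class \<open>j\<close> are the positions \<open>0, \<dots>, n j - 1\<close>, ordered by the one coordinate in which
  they are degenerate, and \<open>{lo j k b..<hi j k b}\<close> is the set of positions of class \<open>k\<close> met by the
  element \<open>b\<close> of class \<open>j\<close>.
\<close>

locale position_system =
  fixes r t :: nat and n :: "nat \<Rightarrow> nat" and lo hi :: "nat \<Rightarrow> nat \<Rightarrow> nat \<Rightarrow> nat"
  assumes r_pos: "1 \<le> r" and t_pos: "1 \<le> t"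
begin

section \<open>Edges and their segments of candidates\<close>

definition inc :: "nat \<Rightarrow> nat \<Rightarrow> nat \<Rightarrow> nat \<Rightarrow> bool" where
  "inc j k b c \<longleftrightarrow> lo j k b \<le> c \<and> c < hi j k b"

definition edges :: "(nat \<Rightarrow> nat) set" where
  "edges = {v \<in> \<Pi>\<^sub>E j\<in>{1..r}. {..<n j}. \<forall>j\<in>{1..r}. \<forall>k\<in>{1..r}. j \<noteq> k \<longrightarrow> inc j k (v j) (v k)}"

text \<open>
  Classes are treated in the order \<open>1, \<dots>, r\<close>. Below, \<open>s k\<close> is the end of a segment \<open>{v k..s k}\<close> already
  chosen in class \<open>k\<close>. A candidate in class \<open>j\<close> is compatible with \<open>v l\<close> for the later classes \<open>l\<close> but
  only has to meet the segments of the earlier ones; this slack is what lets the candidate set serve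
  as a common container for whole fibres of edges in the double counting.
\<close>

definition cand :: "(nat \<Rightarrow> nat) \<Rightarrow> (nat \<Rightarrow> nat) \<Rightarrow> nat \<Rightarrow> nat set" where
  "cand v s j = {b \<in> {v j..<n j}. (\<forall>l\<in>{j<..r}. inc l j (v l) b \<and> inc j l b (v l)) \<and>
     (\<forall>k\<in>{1..<j}. lo j k b \<le> s k \<and> v k < hi j k b)}"

text \<open>\<open>cand\<close> reads \<open>s\<close> only below \<open>j\<close>. As a congruence
  rule this shows that the recursion for \<open>reach\<close> calls itself at smaller classes
  only.\<close>

lemma cand_cong [fundef_cong]:
  "v = v' \<Longrightarrow> j = j' \<Longrightarrow> (\<And>k. 1 \<le> k \<Longrightarrow> k < j' \<Longrightarrow> s k = s' k) \<Longrightarrow> cand v s j = cand v' s' j'"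
  by (auto simp: cand_def)

text \<open>The right end of a segment holding \<open>r * t\<close> candidates. This number leaves
  \<open>t\<close> of them after each of the \<open>r - 1\<close> other classes has spoiled up to
  \<open>t\<close>. With too few candidates the segment shrinks to the point
  \<open>a\<close>.\<close>

definition stop :: "nat set \<Rightarrow> nat \<Rightarrow> nat" where
  "stop A a = (if r * t \<le> card A then SOME m. m \<in> A \<and> card (A \<inter> {..m}) = r * t else a)"

function reach :: "(nat \<Rightarrow> nat) \<Rightarrow> nat \<Rightarrow> nat" where
  "reach v j = stop (cand v (\<lambda>k. reach v k) j) (v j)"
  by auto
termination by (relation "measure snd") auto

declare reach.simps [simp del]

definition ahead :: "(nat \<Rightarrow> nat) \<Rightarrow> nat \<Rightarrow> nat set" where
  "ahead v j = cand v (reach v) j"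

definition near :: "(nat \<Rightarrow> nat) \<Rightarrow> nat \<Rightarrow> nat set" where
  "near v j = ahead v j \<inter> {..reach v j}"

lemma finite_ahead [simp]: "finite (ahead v j)"
  by (auto simp: ahead_def cand_def)

lemma finite_near [simp]: "finite (near v j)"
  by (auto simp: near_def)

lemma rt_pos: "1 \<le> r * t"
  using r_pos t_pos by simp

lemma reach_long:
  assumes "r * t \<le> card (ahead v j)"
  shows "reach v j \<in> ahead v j" "card (near v j) = r * t"
proof -
  have "reach v j = (SOME m. m \<in> ahead v j \<and> card (ahead v j \<inter> {..m}) = r * t)"
    using assms by (subst reach.simps) (simp add: stop_def ahead_def)
  moreover have "\<exists>m. m \<in> ahead v j \<and> card (ahead v j \<inter> {..m}) = r * t"
    using ex_initial_segment_card[OF finite_ahead rt_pos assms] by blast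
  ultimately have "reach v j \<in> ahead v j \<and> card (ahead v j \<inter> {..reach v j}) = r * t"
    by (metis (mono_tags, lifting) someI_ex)
  then show "reach v j \<in> ahead v j" "card (near v j) = r * t" by (auto simp: near_def)
qed

lemma reach_short: "card (ahead v j) < r * t \<Longrightarrow> reach v j = v j"
  by (subst reach.simps) (simp add: stop_def ahead_def)

lemma ahead_ge: "b \<in> ahead v j \<Longrightarrow> v j \<le> b"
  by (simp add: ahead_def cand_def)

lemma le_reach: "v j \<le> reach v j"
  using reach_long(1)[of v j] reach_short[of v j] ahead_ge by (metis le_refl not_le)

lemma edges_inc: "v \<in> edges \<Longrightarrow> j \<in> {1..r} \<Longrightarrow> k \<in> {1..r} \<Longrightarrow> j \<noteq> k \<Longrightarrow> inc j k (v j) (v k)"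
  by (simp add: edges_def)

lemma edges_less: "v \<in> edges \<Longrightarrow> j \<in> {1..r} \<Longrightarrow> v j < n j"
  by (auto simp: edges_def)

lemma edges_ext: "v \<in> edges \<Longrightarrow> v \<in> extensional {1..r}"
  by (auto simp: edges_def PiE_def)

lemma finite_edges [simp]: "finite edges"
proof -
  have "edges \<subseteq> (\<Pi>\<^sub>E j\<in>{1..r}. {..<n j})" by (auto simp: edges_def)
  then show ?thesis by (rule finite_subset) (intro finite_PiE, auto)
qed

text \<open>Meeting \<open>v k\<close> implies meeting the segment from \<open>v k\<close> to
  \<open>reach v k\<close>. Hence, among edges that differ only in class \<open>j\<close>, the one
  with the smallest entry there has all other entries as candidates.\<close>

lemma fibre_in_ahead:
  assumes "v \<in> edges" "w \<in> edges" "j \<in> {1..r}" "\<And>l. l \<in> {1..r} \<Longrightarrow> l \<noteq> j \<Longrightarrow> w l = v l" "v j \<le> w j"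
  shows "w j \<in> ahead v j"
proof -
  have "inc l j (v l) (w j) \<and> inc j l (w j) (v l)" if "l \<in> {1..r}" "l \<noteq> j" for l
    using edges_inc[OF assms(2), of l j] edges_inc[OF assms(2), of j l] that assms(3,4) by auto
  then show ?thesis
    using assms(3,5) edges_less[OF assms(2)] order_trans[OF _ le_reach]
    by (auto simp: ahead_def cand_def inc_def)
qed

lemma reach_in_ahead:
  assumes "v \<in> edges" "j \<in> {1..r}"
  shows "reach v j \<in> ahead v j"
proof (cases "r * t \<le> card (ahead v j)")
  case False
  then show ?thesis using reach_short[of v j] fibre_in_ahead[OF assms(1,1,2)] by simp
qed (rule reach_long)

lemma card_near_le:
  assumes "v \<in> edges" "j \<in> {1..r}"
  shows "card (near v j) \<le> r * t"
proof (cases "r * t \<le> card (ahead v j)")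
  case False
  then show ?thesis
    using card_mono[OF finite_ahead, of "near v j" v j] by (auto simp: near_def)
qed (simp add: reach_long)

lemma ahead_inc: "b \<in> ahead v j \<Longrightarrow> l \<in> {j<..r} \<Longrightarrow> inc l j (v l) b \<and> inc j l b (v l)"
  by (simp add: ahead_def cand_def)

text \<open>The interval of \<open>v j\<close> contains both ends of the segment: \<open>v k\<close>
  because \<open>v\<close> is an edge, \<open>reach v k\<close> because candidates are compatible
  with the later members of \<open>v\<close>. Convexity does the rest.\<close>

lemma inc_segment:
  assumes "v \<in> edges" "k \<in> {1..r}" "j \<in> {1..r}" "k < j" "v k \<le> p" "p \<le> reach v k"
  shows "inc j k (v j) p"
  using edges_inc[OF assms(1), of j k] ahead_inc[OF reach_in_ahead[OF assms(1,2)], of j] assms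
  by (auto simp: inc_def)

section \<open>Fibres of edges through given positions\<close>

lemma restrict_in_box:
  "(\<And>l. l \<in> A \<Longrightarrow> f l < n l) \<Longrightarrow> restrict f A \<in> (\<Pi>\<^sub>E l\<in>A. {..<n l})"
  by (rule restrict_PiE_iff[THEN iffD2]) simp

text \<open>For the \<open>v\<close> in \<open>X\<close> with the smallest entry at
  \<open>j\<close>, all entries \<open>u j\<close> are candidates and satisfy
  \<open>u j \<le> p \<le> reach v j\<close>, so they lie in \<open>near v j\<close>.\<close>

lemma card_fibre_through:
  assumes "j \<in> {1..r}"
    and X: "X \<subseteq> {v \<in> edges. (\<forall>l\<in>{1..r} - {j}. v l = w l) \<and> v j \<le> p \<and> p \<le> reach v j}"
  shows "card X \<le> r * t"
proof (cases "X = {}")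
  case False
  obtain v where v: "v \<in> X" "\<And>u. u \<in> X \<Longrightarrow> v j \<le> u j"
    using ex_has_least_nat[of "\<lambda>u. u \<in> X" _ "\<lambda>u. u j"] False by auto
  have XD: "u \<in> edges" "u j \<le> p" "p \<le> reach u j" "\<And>l. l \<in> {1..r} \<Longrightarrow> l \<noteq> j \<Longrightarrow> u l = w l"
    if "u \<in> X" for u
    using subsetD[OF X that] by simp_all
  have "inj_on (\<lambda>u. u j) X"
  proof (rule inj_onI)
    fix a b assume ab: "a \<in> X" "b \<in> X" "a j = b j"
    show "a = b"
    proof (rule extensionalityI[of _ "{1..r}"])
      show "a \<in> extensional {1..r}" "b \<in> extensional {1..r}" using ab XD(1) edges_ext by auto
      show "a i = b i" if "i \<in> {1..r}" for i
        using ab(3) XD(4)[OF ab(1) that] XD(4)[OF ab(2) that] by (cases "i = j") simp_all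
    qed
  qed
  then have "card X = card ((\<lambda>u. u j) ` X)" by (simp add: card_image)
  also have "\<dots> \<le> card (near v j)"
  proof (rule card_mono)
    show "(\<lambda>u. u j) ` X \<subseteq> near v j"
    proof safe
      fix u assume u: "u \<in> X"
      have "u j \<in> ahead v j"
        by (rule fibre_in_ahead[OF XD(1)[OF v(1)] XD(1)[OF u] assms(1)]) (simp_all add: u v XD)
      moreover have "u j \<le> reach v j" using XD(2)[OF u] XD(3)[OF v(1)] by simp
      ultimately show "u j \<in> near v j" by (simp add: near_def)
    qed
  qed simp
  also have "\<dots> \<le> r * t" using v(1) X assms(1) by (intro card_near_le) auto
  finally show ?thesis .
qed simp

text \<open>The entries in the later class \<open>j\<close> all lie in \<open>near v j\<close> for
  the lowest \<open>v\<close>. Once such an entry is fixed, only class \<open>k\<close> is free and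
  \<open>card_fibre_through\<close> applies.\<close>

lemma card_double_fibre_through:
  fixes w :: "nat \<Rightarrow> nat" and p q :: nat
  assumes j: "j \<in> {1..r}" and k: "k \<in> {1..r}" and kj: "k < j"
  defines "X \<equiv> {v \<in> edges. (\<forall>l\<in>{1..r} - {j, k}. v l = w l) \<and> v k \<le> p \<and> p \<le> reach v k \<and>
    v j \<le> q \<and> q \<le> reach v j}"
  shows "card X \<le> (r * t) * (r * t)"
proof (cases "X = {}")
  case False
  have XE: "X \<subseteq> edges" by (auto simp: X_def)
  have fX: "finite X" using XE by (rule finite_subset) simp
  obtain v where v: "v \<in> X" "\<And>u. u \<in> X \<Longrightarrow> v j \<le> u j"
    using ex_has_least_nat[of "\<lambda>u. u \<in> X" _ "\<lambda>u. u j"] False by auto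
  have sub: "(\<lambda>u. u j) ` X \<subseteq> near v j"
  proof safe
    fix u assume u: "u \<in> X"
    then have uE: "u \<in> edges" and vE: "v \<in> edges" using XE v by auto
    \<comment> \<open>\<open>u j\<close> need not meet \<open>v k\<close>, but it meets
      \<open>p\<close>, which also lies in the segment of \<open>v\<close> in class
      \<open>k\<close>. This is all that \<open>cand\<close> asks for.\<close>
    have p: "inc j k (u j) p" using u by (intro inc_segment[OF uE k j kj]) (auto simp: X_def)
    have eq: "u l = v l" if "l \<in> {1..r}" "l \<noteq> j" "l \<noteq> k" for l
      using u v(1) that by (auto simp: X_def)
    have 1: "inc l j (v l) (u j) \<and> inc j l (u j) (v l)" if "l \<in> {1..r}" "l \<noteq> j" "l \<noteq> k" for l
      using edges_inc[OF uE, of j l] edges_inc[OF uE, of l j] that j eq by auto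
    have "lo j i (u j) \<le> reach v i \<and> v i < hi j i (u j)" if i: "i \<in> {1..<j}" for i
    proof (cases "i = k")
      case True
      then show ?thesis using p v(1) by (auto simp: X_def inc_def)
    next
      case False
      then show ?thesis using 1[of i] i j le_reach[of v i] by (auto simp: inc_def)
    qed
    moreover have "\<forall>l\<in>{j<..r}. inc l j (v l) (u j) \<and> inc j l (u j) (v l)" using 1 kj by auto
    ultimately have "u j \<in> ahead v j"
      using v(2)[OF u] edges_less[OF uE j] by (auto simp: ahead_def cand_def)
    moreover have "u j \<le> reach v j" using u v(1) by (auto simp: X_def)
    ultimately show "u j \<in> near v j" by (simp add: near_def)
  qed
  have "card X \<le> (r * t) * card (near v j)"
  proof (rule card_le_fibres[OF fX _ sub])
    fix y assume "y \<in> near v j"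
    show "card {x \<in> X. x j = y} \<le> r * t"
      by (rule card_fibre_through[OF k, of _ "w(j := y)" p]) (auto simp: X_def)
  qed simp
  also have "\<dots> \<le> (r * t) * (r * t)"
    using card_near_le[of v j] v(1) XE j by (intro mult_left_mono) auto
  finally show ?thesis .
qed simp

section \<open>Edges with few candidates\<close>

definition faces :: "nat \<Rightarrow> nat" where
  "faces j = (\<Prod>k\<in>{1..r} - {j}. n k)"

lemma card_faces: "card (\<Pi>\<^sub>E l\<in>{1..r} - {j}. {..<n l}) = faces j"
  by (simp add: card_PiE faces_def)

definition Short :: "nat \<Rightarrow> (nat \<Rightarrow> nat) set" where
  "Short j = {v \<in> edges. card (ahead v j) < r * t}"

text \<open>Forget the entry in class \<open>j\<close>. The lowest edge of a fibre has all entries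
  of the fibre among its fewer than \<open>r * t\<close> candidates.\<close>

lemma card_Short:
  assumes j: "j \<in> {1..r}"
  shows "card (Short j) \<le> (r * t) * faces j"
  unfolding card_faces[symmetric]
proof (rule card_le_fibres[where f = "\<lambda>v. restrict v ({1..r} - {j})"])
  show "(\<lambda>v. restrict v ({1..r} - {j})) ` Short j \<subseteq> (\<Pi>\<^sub>E l\<in>{1..r} - {j}. {..<n l})"
    by (rule image_subsetI, rule restrict_in_box) (use edges_less in \<open>auto simp: Short_def\<close>)
next
  fix w :: "nat \<Rightarrow> nat"
  let ?X = "{v \<in> Short j. restrict v ({1..r} - {j}) = w}"
  show "card ?X \<le> r * t"
  proof (cases "?X = {}")
    case False
    obtain v where v: "v \<in> ?X" "\<And>u. u \<in> ?X \<Longrightarrow> v j \<le> u j"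
      using ex_has_least_nat[of "\<lambda>u. u \<in> ?X" _ "\<lambda>u. u j"] False by auto
    have eq: "a i = b i" if "a \<in> ?X" "b \<in> ?X" "i \<in> {1..r}" "i \<noteq> j" for a b i
    proof -
      have "restrict a ({1..r} - {j}) i = restrict b ({1..r} - {j}) i" using that by auto
      then show ?thesis using that by auto
    qed
    have "inj_on (\<lambda>u. u j) ?X"
    proof (rule inj_onI)
      fix a b assume ab: "a \<in> ?X" "b \<in> ?X" "a j = b j"
      show "a = b"
      proof (rule extensionalityI[of _ "{1..r}"])
        show "a \<in> extensional {1..r}" "b \<in> extensional {1..r}" using ab edges_ext by (auto simp: Short_def)
        show "a i = b i" if "i \<in> {1..r}" for i using ab eq[OF ab(1,2) that] by (cases "i = j") auto
      qed
    qed
    then have "card ?X = card ((\<lambda>u. u j) ` ?X)" by (simp add: card_image)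
    also have "\<dots> \<le> card (ahead v j)"
    proof (rule card_mono)
      show "(\<lambda>u. u j) ` ?X \<subseteq> ahead v j"
      proof (rule image_subsetI)
        fix u assume u: "u \<in> ?X"
        show "u j \<in> ahead v j"
          by (rule fibre_in_ahead) (use u v j eq[OF u v(1)] in \<open>auto simp: Short_def\<close>)
      qed
    qed simp
    also have "\<dots> \<le> r * t" using v(1) by (auto simp: Short_def)
    finally show ?thesis .
  next
    case True
    show ?thesis unfolding True by simp
  qed
qed (auto simp: Short_def intro!: finite_PiE)

text \<open>
  A member of \<open>near v j\<close> is bad for \<open>k < j\<close> if one of its ends falls into the segment of class \<open>k\<close>; a
  member of \<open>near v k\<close> is bad for \<open>j > k\<close> if its interval ends inside the segment of class \<open>j\<close>. An edge
  with \<open>t\<close> bad members is charged to each of the corresponding ends with weight \<open>1 / t\<close>, and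
  \<open>card_double_fibre_through\<close> shows that an end is charged by at most \<open>(r * t)\<^sup>2\<close> edges.
\<close>

definition bad_new :: "(nat \<Rightarrow> nat) \<Rightarrow> nat \<Rightarrow> nat \<Rightarrow> nat set" where
  "bad_new v j k = {b \<in> near v j. \<not> (lo j k b \<le> v k \<and> reach v k < hi j k b)}"

definition bad_old :: "(nat \<Rightarrow> nat) \<Rightarrow> nat \<Rightarrow> nat \<Rightarrow> nat set" where
  "bad_old v k j = {b \<in> near v k. hi k j b \<le> reach v j}"

definition Bad_new :: "nat \<Rightarrow> nat \<Rightarrow> (nat \<Rightarrow> nat) set" where
  "Bad_new j k = {v \<in> edges. t \<le> card (bad_new v j k)}"

definition Bad_old :: "nat \<Rightarrow> nat \<Rightarrow> (nat \<Rightarrow> nat) set" where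
  "Bad_old k j = {v \<in> edges. t \<le> card (bad_old v k j)}"

lemma ahead_less: "b \<in> ahead v j \<Longrightarrow> b < n j"
  by (simp add: ahead_def cand_def)

text \<open>Each \<open>v\<close> carries at least \<open>t\<close> pairs, so a bound quadratic in
  \<open>t\<close> for the pairs becomes linear for \<open>A\<close>.\<close>

lemma weighted_count:
  assumes "finite A" "\<And>v. v \<in> A \<Longrightarrow> finite (S v)" "\<And>v. v \<in> A \<Longrightarrow> t \<le> card (S v)"
    and "card (Sigma A S) \<le> c * (r * t * (r * t))"
  shows "card A \<le> c * (r * r * t)"
proof -
  have "t * card A = (\<Sum>v\<in>A. t)" by simp
  also have "\<dots> \<le> (\<Sum>v\<in>A. card (S v))" by (rule sum_mono) (rule assms)
  also have "\<dots> = card (Sigma A S)" using assms(1,2) by (subst card_SigmaI) auto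
  also have "\<dots> \<le> t * (c * (r * r * t))" using assms(4) by (simp add: algebra_simps)
  finally show ?thesis using t_pos by simp
qed

text \<open>A pair \<open>(v, b)\<close> is sent to the tuple with \<open>b\<close> in place of
  \<open>v j\<close> and class \<open>k\<close> forgotten, together with one bit telling which end
  of \<open>b\<close> lies in the segment of class \<open>k\<close>. The image determines
  \<open>b\<close> and that end, so the double fibre bound applies.\<close>

lemma card_Bad_new:
  assumes j: "j \<in> {1..r}" and k: "k \<in> {1..r}" and kj: "k < j"
  shows "card (Bad_new j k) \<le> (2 * faces k) * (r * r * t)"
proof (rule weighted_count[where S = "\<lambda>v. bad_new v j k"])
  let ?Q = "Sigma (Bad_new j k) (\<lambda>v. bad_new v j k)"
  let ?W = "(UNIV :: bool set) \<times> (\<Pi>\<^sub>E l\<in>{1..r} - {k}. {..<n l})"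
  let ?f = "\<lambda>(v, b). (v k < lo j k b, restrict (v(j := b)) ({1..r} - {k}))"
  have fQ: "finite ?Q" by (intro finite_SigmaI) (auto simp: Bad_new_def bad_new_def)
  have "card ?Q \<le> (r * t * (r * t)) * card ?W"
  proof (rule card_le_fibres[OF fQ, where f = ?f])
    show "finite ?W" by (intro finite_cartesian_product finite_PiE) auto
    show "?f ` ?Q \<subseteq> ?W"
    proof (rule image_subsetI, unfold case_prod_unfold, rule SigmaI[OF UNIV_I], rule restrict_in_box)
      fix x l assume "x \<in> ?Q" "l \<in> {1..r} - {k}"
      then show "((fst x)(j := snd x)) l < n l" using edges_less ahead_less
        by (auto simp: Bad_new_def bad_new_def near_def)
    qed
  next
    fix y assume "y \<in> ?W"
    obtain s w where y: "y = (s, w)" by (cases y)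
    define p where "p = (if s then lo j k (w j) else hi j k (w j))"
    let ?X = "{v \<in> edges. (\<forall>l\<in>{1..r} - {j, k}. v l = w l) \<and> v k \<le> p \<and> p \<le> reach v k \<and>
      v j \<le> w j \<and> w j \<le> reach v j}"
    let ?F = "{x \<in> ?Q. ?f x = y}"
    have b: "snd x = w j" if "x \<in> ?F" for x
    proof -
      have "restrict ((fst x)(j := snd x)) ({1..r} - {k}) j = w j"
        using that by (auto simp: case_prod_unfold y)
      then show ?thesis using j kj by auto
    qed
    have "card ?F = card (fst ` ?F)"
    proof (rule card_image[symmetric], rule inj_onI)
      fix x x' assume "x \<in> ?F" "x' \<in> ?F" "fst x = fst x'"
      then show "x = x'" using b[of x] b[of x'] by (simp only: prod_eq_iff)
    qed
    also have "\<dots> \<le> card ?X"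
    proof (rule card_mono)
      show "fst ` ?F \<subseteq> ?X"
      proof (rule image_subsetI)
        fix x assume x: "x \<in> ?F"
        obtain v c where xc: "x = (v, c)" by (cases x)
        have vb: "(v, w j) \<in> ?F" using x b[OF x] by (simp only: xc snd_conv)
        then have vE: "v \<in> edges" and bd: "w j \<in> bad_new v j k" and s: "s = (v k < lo j k (w j))"
          and w: "restrict (v(j := w j)) ({1..r} - {k}) = w"
          using y by (auto simp: Bad_new_def)
        have wl: "v l = w l" if "l \<in> {1..r}" "l \<noteq> j" "l \<noteq> k" for l
          using fun_cong[OF w, of l] that by auto
        have wC: "w j \<in> ahead v j" "w j \<le> reach v j" using bd by (auto simp: bad_new_def near_def)
        \<comment> \<open>As a candidate, \<open>w j\<close> meets the segment. Being bad, it has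
          \<open>lo\<close> above \<open>v k\<close> or \<open>hi\<close> at most
          \<open>reach v k\<close>, so the end selected by \<open>s\<close> lies in the
          segment.\<close>
        have "lo j k (w j) \<le> reach v k" "v k < hi j k (w j)"
          using wC(1) k kj by (auto simp: ahead_def cand_def)
        then have "v k \<le> p \<and> p \<le> reach v k"
          using bd s by (auto simp: p_def bad_new_def)
        then show "fst x \<in> ?X" using vE wl wC ahead_ge xc by auto
      qed
    qed simp
    also have "\<dots> \<le> (r * t * (r * t))"
      by (rule card_double_fibre_through[OF j k kj])
    finally show "card ?F \<le> (r * t * (r * t))" .
  qed
  then show "card ?Q \<le> (2 * faces k) * (r * t * (r * t))"
    by (simp only: card_cartesian_product card_faces card_UNIV_bool mult.commute mult.left_commute)
qed (auto simp: Bad_new_def bad_new_def)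

lemma card_Bad_old:
  assumes j: "j \<in> {1..r}" and k: "k \<in> {1..r}" and kj: "k < j"
  shows "card (Bad_old k j) \<le> faces j * (r * r * t)"
proof (rule weighted_count[where S = "\<lambda>v. bad_old v k j"])
  let ?Q = "Sigma (Bad_old k j) (\<lambda>v. bad_old v k j)"
  let ?W = "\<Pi>\<^sub>E l\<in>{1..r} - {j}. {..<n l}"
  let ?f = "\<lambda>(v, b). restrict (v(k := b)) ({1..r} - {j})"
  have fQ: "finite ?Q" by (intro finite_SigmaI) (auto simp: Bad_old_def bad_old_def)
  have "card ?Q \<le> (r * t * (r * t)) * card ?W"
  proof (rule card_le_fibres[OF fQ, where f = ?f])
    show "finite ?W" by (intro finite_PiE) auto
    show "?f ` ?Q \<subseteq> ?W"
    proof (rule image_subsetI, unfold case_prod_unfold, rule restrict_in_box)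
      fix x l assume "x \<in> ?Q" "l \<in> {1..r} - {j}"
      then show "((fst x)(k := snd x)) l < n l" using edges_less ahead_less
        by (auto simp: Bad_old_def bad_old_def near_def)
    qed
  next
    fix w assume "w \<in> ?W"
    let ?X = "{v \<in> edges. (\<forall>l\<in>{1..r} - {j, k}. v l = w l) \<and> v k \<le> w k \<and> w k \<le> reach v k \<and>
      v j \<le> hi k j (w k) \<and> hi k j (w k) \<le> reach v j}"
    let ?F = "{x \<in> ?Q. ?f x = w}"
    have b: "snd x = w k" if "x \<in> ?F" for x
    proof -
      have "restrict ((fst x)(k := snd x)) ({1..r} - {j}) k = w k"
        using that by (auto simp: case_prod_unfold)
      then show ?thesis using k kj by auto
    qed
    have "card ?F = card (fst ` ?F)"
    proof (rule card_image[symmetric], rule inj_onI)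
      fix x x' assume "x \<in> ?F" "x' \<in> ?F" "fst x = fst x'"
      then show "x = x'" using b[of x] b[of x'] by (simp only: prod_eq_iff)
    qed
    also have "\<dots> \<le> card ?X"
    proof (rule card_mono)
      show "fst ` ?F \<subseteq> ?X"
      proof (rule image_subsetI)
        fix x assume x: "x \<in> ?F"
        obtain v c where xc: "x = (v, c)" by (cases x)
        have vb: "(v, w k) \<in> ?F" using x b[OF x] by (simp only: xc snd_conv)
        then have vE: "v \<in> edges" and bd: "w k \<in> bad_old v k j"
          and w: "restrict (v(k := w k)) ({1..r} - {j}) = w"
          by (auto simp: Bad_old_def)
        have wl: "v l = w l" if "l \<in> {1..r}" "l \<noteq> j" "l \<noteq> k" for l
          using fun_cong[OF w, of l] that by auto
        have wC: "w k \<in> ahead v k" "w k \<le> reach v k" using bd by (auto simp: bad_old_def near_def)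
        have "inc k j (w k) (v j)"
          using ahead_inc[OF wC(1), of j] j kj by auto
        then have "v j \<le> hi k j (w k) \<and> hi k j (w k) \<le> reach v j"
          using bd by (auto simp: inc_def bad_old_def)
        then show "fst x \<in> ?X" using vE wl wC ahead_ge xc by auto
      qed
    qed simp
    also have "\<dots> \<le> (r * t * (r * t))"
      by (rule card_double_fibre_through[OF j k kj])
    finally show "card ?F \<le> (r * t * (r * t))" .
  qed
  then show "card ?Q \<le> faces j * (r * t * (r * t))"
    by (simp only: card_faces mult.commute)
qed (auto simp: Bad_old_def bad_old_def)

section \<open>Complete subhypergraphs of surviving elements\<close>

definition good :: "(nat \<Rightarrow> nat) \<Rightarrow> nat \<Rightarrow> nat set" where
  "good v j = near v j - (\<Union>k\<in>{1..<j}. bad_new v j k) - (\<Union>l\<in>{j<..r}. bad_old v j l)"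

text \<open>For \<open>k < j\<close>, the interval of a good \<open>w j\<close> covers the whole
  segment of class \<open>k\<close>, which contains \<open>w k\<close>. Conversely,
  \<open>w k\<close> is compatible with \<open>v j\<close> and its interval does not end before
  passing \<open>reach v j\<close>, so it contains \<open>w j\<close>.\<close>

lemma good_transversal:
  assumes v: "v \<in> edges"
  shows "(\<Pi>\<^sub>E j\<in>{1..r}. good v j) \<subseteq> edges"
proof
  fix w assume w: "w \<in> (\<Pi>\<^sub>E j\<in>{1..r}. good v j)"
  have wC: "w j \<in> ahead v j" "w j \<le> reach v j" if "j \<in> {1..r}" for j
    using w that by (auto simp: good_def near_def PiE_iff)
  have *: "inc j k (w j) (w k) \<and> inc k j (w k) (w j)" if j: "j \<in> {1..r}" and k: "k \<in> {1..r}" and kj: "k < j" for j k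
  proof
    have gj: "w j \<in> good v j" and gk: "w k \<in> good v k" using w j k by auto
    have "lo j k (w j) \<le> v k" "reach v k < hi j k (w j)"
      using gj k kj by (auto simp: good_def bad_new_def)
    then show "inc j k (w j) (w k)" using wC[OF k] ahead_ge[OF wC(1)[OF k]] by (auto simp: inc_def)
    have "w k \<notin> bad_old v k j" "w k \<in> near v k" using gk j kj by (auto simp: good_def)
    then have "reach v j < hi k j (w k)" by (simp add: bad_old_def)
    moreover have "lo k j (w k) \<le> v j" using ahead_inc[OF wC(1)[OF k], of j] j kj by (auto simp: inc_def)
    ultimately show "inc k j (w k) (w j)"
      using wC[OF j] ahead_ge[OF wC(1)[OF j]] by (auto simp: inc_def)
  qed
  have "inc j k (w j) (w k)" if "j \<in> {1..r}" "k \<in> {1..r}" "j \<noteq> k" for j k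
    using *[of j k] *[of k j] that by (meson linorder_neqE_nat)
  moreover have "w j < n j" if "j \<in> {1..r}" for j using ahead_less[OF wC(1)[OF that]] .
  ultimately show "w \<in> edges" using w by (auto simp: edges_def PiE_iff)
qed

text \<open>Each of the \<open>r - 1\<close> other classes removes at most \<open>t\<close> of the
  \<open>r * t\<close> members of \<open>near v j\<close>.\<close>

lemma card_good:
  assumes v: "v \<in> edges" and j: "j \<in> {1..r}" and "v \<notin> Short j"
    and "\<And>k. k \<in> {1..<j} \<Longrightarrow> v \<notin> Bad_new j k"
    and "\<And>l. l \<in> {j<..r} \<Longrightarrow> v \<notin> Bad_old j l"
  shows "t \<le> card (good v j)"
proof -
  let ?A = "\<Union>k\<in>{1..<j}. bad_new v j k" and ?B = "\<Union>l\<in>{j<..r}. bad_old v j l"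
  have fin: "finite (bad_new v j k)" "finite (bad_old v j k)" for k
    by (auto simp: bad_new_def bad_old_def)
  have "card ?A \<le> (\<Sum>k\<in>{1..<j}. card (bad_new v j k))" by (rule card_UN_le) simp
  also have "\<dots> \<le> (\<Sum>k\<in>{1..<j}. t)"
    by (rule sum_mono) (use assms(4) v in \<open>force simp: Bad_new_def\<close>)
  finally have A: "card ?A \<le> (j - 1) * t" by simp
  have "card ?B \<le> (\<Sum>l\<in>{j<..r}. card (bad_old v j l))" by (rule card_UN_le) simp
  also have "\<dots> \<le> (\<Sum>l\<in>{j<..r}. t)"
    by (rule sum_mono) (use assms(5) v in \<open>force simp: Bad_old_def\<close>)
  finally have B: "card ?B \<le> (r - j) * t" by simp
  have "card (near v j) = r * t"
    using assms(3) v by (intro reach_long) (auto simp: Short_def)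
  moreover have "card (near v j) - card ?A \<le> card (near v j - ?A)"
    by (rule diff_card_le_card_Diff) (use fin in auto)
  moreover have "card (near v j - ?A) - card ?B \<le> card (good v j)"
    unfolding good_def by (rule diff_card_le_card_Diff) (use fin in auto)
  moreover have "r * t = (j - 1) * t + (r - j) * t + t"
  proof -
    have "r = (j - 1) + (r - j) + 1" using j by auto
    then show ?thesis by (metis add_mult_distrib mult_1)
  qed
  ultimately show ?thesis using A B by linarith
qed

text \<open>An edge outside all exceptional sets has \<open>t\<close> good elements in every class,
  and by \<open>good_transversal\<close> these span a forbidden subhypergraph.\<close>

lemma edges_cover:
  assumes free: "\<nexists>T. (\<forall>j\<in>{1..r}. T j \<subseteq> {..<n j} \<and> card (T j) = t) \<and> (\<Pi>\<^sub>E j\<in>{1..r}. T j) \<subseteq> edges"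
  shows "edges \<subseteq> (\<Union>j\<in>{1..r}. Short j \<union> (\<Union>k\<in>{1..<j}. Bad_new j k \<union> Bad_old k j))"
proof (rule ccontr)
  assume "\<not> ?thesis"
  then obtain v where v: "v \<in> edges" and S: "\<And>j. j \<in> {1..r} \<Longrightarrow> v \<notin> Short j"
    and N: "\<And>j k. j \<in> {1..r} \<Longrightarrow> k \<in> {1..<j} \<Longrightarrow> v \<notin> Bad_new j k"
    and O: "\<And>j k. j \<in> {1..r} \<Longrightarrow> k \<in> {1..<j} \<Longrightarrow> v \<notin> Bad_old k j"
    by blast
  have "t \<le> card (good v j)" if j: "j \<in> {1..r}" for j
    by (rule card_good) (use v S N O j in auto)
  then have "\<forall>j\<in>{1..r}. \<exists>T. T \<subseteq> good v j \<and> card T = t"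
    by (meson obtain_subset_with_card_n)
  then obtain T where T: "\<And>j. j \<in> {1..r} \<Longrightarrow> T j \<subseteq> good v j \<and> card (T j) = t" by metis
  have "T j \<subseteq> {..<n j}" if "j \<in> {1..r}" for j
  proof
    fix b assume "b \<in> T j"
    then have "b \<in> ahead v j" using T[OF that] by (auto simp: good_def near_def)
    then show "b \<in> {..<n j}" using ahead_less by simp
  qed
  moreover have "(\<Pi>\<^sub>E j\<in>{1..r}. T j) \<subseteq> edges"
    by (rule order_trans[OF PiE_mono good_transversal[OF v]]) (use T in auto)
  ultimately show False using free T by (metis (no_types, lifting))
qed

text \<open>\<open>Short\<close> costs \<open>r * t\<close> per face. Each of at most
  \<open>r * r\<close> pairs \<open>k < j\<close> costs \<open>3 * (r * r * t)\<close> times the sum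
  of the faces, two parts for \<open>Bad_new\<close> and one for \<open>Bad_old\<close>.\<close>

lemma card_edges:
  assumes free: "\<nexists>T. (\<forall>j\<in>{1..r}. T j \<subseteq> {..<n j} \<and> card (T j) = t) \<and> (\<Pi>\<^sub>E j\<in>{1..r}. T j) \<subseteq> edges"
  shows "card edges \<le> (r + 3 * r ^ 4) * t * (\<Sum>j\<in>{1..r}. faces j)"
proof -
  define G where "G = (\<Sum>j\<in>{1..r}. faces j)"
  have faces_le: "faces j \<le> G" if "j \<in> {1..r}" for j
    unfolding G_def by (rule member_le_sum) (use that in auto)
  let ?N = "\<lambda>j. \<Union>k\<in>{1..<j}. Bad_new j k \<union> Bad_old k j"
  have N: "card (?N j) \<le> r * (3 * (r * r * t) * G)" if j: "j \<in> {1..r}" for j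
  proof -
    have "card (?N j) \<le> (\<Sum>k\<in>{1..<j}. card (Bad_new j k \<union> Bad_old k j))"
      by (rule card_UN_le) simp
    also have "\<dots> \<le> (\<Sum>k\<in>{1..<j}. 3 * (r * r * t) * G)"
    proof (rule sum_mono)
      fix k assume k: "k \<in> {1..<j}"
      then have k': "k \<in> {1..r}" "k < j" using j by auto
      have "card (Bad_new j k \<union> Bad_old k j) \<le> 2 * faces k * (r * r * t) + faces j * (r * r * t)"
        by (rule order_trans[OF card_Un_le add_mono[OF card_Bad_new[OF j k'] card_Bad_old[OF j k']]])
      also have "\<dots> \<le> 2 * G * (r * r * t) + G * (r * r * t)"
        by (intro add_mono mult_right_mono mult_left_mono faces_le j k') auto
      finally show "card (Bad_new j k \<union> Bad_old k j) \<le> 3 * (r * r * t) * G"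
        by (simp add: algebra_simps)
    qed
    also have "\<dots> = (j - 1) * (3 * (r * r * t) * G)" by simp
    also have "\<dots> \<le> r * (3 * (r * r * t) * G)" using j by (intro mult_right_mono) auto
    finally show ?thesis .
  qed
  have fin: "finite (\<Union>j\<in>{1..r}. Short j \<union> ?N j)"
    by (auto simp: Short_def Bad_new_def Bad_old_def)
  have "card edges \<le> card (\<Union>j\<in>{1..r}. Short j \<union> ?N j)"
    by (rule card_mono[OF fin edges_cover[OF free]])
  also have "\<dots> \<le> (\<Sum>j\<in>{1..r}. card (Short j \<union> ?N j))" by (rule card_UN_le) simp
  also have "\<dots> \<le> (\<Sum>j\<in>{1..r}. r * t * faces j + r * (3 * (r * r * t) * G))"
    by (rule sum_mono, rule order_trans[OF card_Un_le], rule add_mono[OF card_Short N])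
  also have "\<dots> = r * t * G + r * (r * (3 * (r * r * t) * G))"
    by (simp add: sum.distrib G_def sum_distrib_left)
  also have "\<dots> = (r + 3 * r ^ 4) * t * G"
    by (simp add: algebra_simps power4_eq_xxxx)
  finally show ?thesis by (simp add: G_def)
qed

end

section \<open>Interval incidences with real keys\<close>

lemma ex_sorted_enumeration:
  fixes x :: "'a \<Rightarrow> real"
  assumes "finite V"
  shows "\<exists>e. bij_betw e {..<card V} V \<and> (\<forall>p q. p \<le> q \<longrightarrow> q < card V \<longrightarrow> x (e p) \<le> x (e q))"
proof -
  obtain ys where ys: "set ys = V" "distinct ys" using finite_distinct_list[OF assms] by blast
  define xs where "xs = sort_key x ys"
  have xs: "set xs = V" "distinct xs" "sorted (map x xs)" using ys by (auto simp: xs_def)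
  have len: "length xs = card V" using distinct_card[OF xs(2)] xs(1) by simp
  have "bij_betw ((!) xs) {..<card V} V"
    by (rule bij_betw_nth) (use xs len in auto)
  moreover have "x (xs ! p) \<le> x (xs ! q)" if "p \<le> q" "q < card V" for p q
    using sorted_nth_mono[OF xs(3) that(1)] that len by simp
  ultimately show ?thesis by blast
qed

text \<open>A finite downward closed set of naturals is \<open>{..<m}\<close> with \<open>m\<close>
  its size. This turns counts of keys into thresholds on positions.\<close>

lemma initial_segment_eq:
  fixes D :: "nat set"
  assumes "finite D" "\<And>p q. p \<in> D \<Longrightarrow> q \<le> p \<Longrightarrow> q \<in> D"
  shows "p < card D \<longleftrightarrow> p \<in> D"
proof -
  have "\<exists>m. D = {..<m}"
  proof (cases "D = {}")
    case False
    have "D \<subseteq> {..Max D}" using assms(1) by auto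
    moreover have "{..Max D} \<subseteq> D" using assms(2)[OF Max_in[OF assms(1) False]] by blast
    ultimately have "D = {..<Suc (Max D)}" by (simp add: lessThan_Suc_atMost)
    then show ?thesis by blast
  qed (auto intro: exI[of _ 0])
  then show ?thesis by auto
qed

text \<open>After sorting each class by its key, the elements with key in a closed interval occupy
  consecutive positions, so this is an instance of \<open>position_system\<close>.\<close>

lemma card_keyed_incidences:
  fixes V :: "nat \<Rightarrow> 'a set" and x :: "nat \<Rightarrow> 'a \<Rightarrow> real" and L U :: "nat \<Rightarrow> nat \<Rightarrow> 'a \<Rightarrow> real"
    and r t :: nat
  defines "H \<equiv> {v \<in> \<Pi>\<^sub>E j\<in>{1..r}. V j. \<forall>j\<in>{1..r}. \<forall>k\<in>{1..r}. j \<noteq> k \<longrightarrow>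
    L j k (v j) \<le> x k (v k) \<and> x k (v k) \<le> U j k (v j)}"
  assumes r: "1 \<le> r" and t: "1 \<le> t" and fin: "\<And>j. j \<in> {1..r} \<Longrightarrow> finite (V j)"
    and free: "\<nexists>T. (\<forall>j\<in>{1..r}. T j \<subseteq> V j \<and> card (T j) = t) \<and> (\<Pi>\<^sub>E j\<in>{1..r}. T j) \<subseteq> H"
  shows "card H \<le> (r + 3 * r ^ 4) * t * (\<Sum>j\<in>{1..r}. \<Prod>k\<in>{1..r} - {j}. card (V k))"
proof -
  have "\<forall>j\<in>{1..r}. \<exists>e. bij_betw e {..<card (V j)} (V j) \<and>
      (\<forall>p q. p \<le> q \<longrightarrow> q < card (V j) \<longrightarrow> x j (e p) \<le> x j (e q))"
    using ex_sorted_enumeration fin by blast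
  then obtain e where e: "\<And>j. j \<in> {1..r} \<Longrightarrow> bij_betw (e j) {..<card (V j)} (V j)"
    and mono: "\<And>j p q. j \<in> {1..r} \<Longrightarrow> p \<le> q \<Longrightarrow> q < card (V j) \<Longrightarrow> x j (e j p) \<le> x j (e j q)"
    by metis
  define n where "n = (\<lambda>j. card (V j))"
  \<comment> \<open>Strictly below \<open>L\<close>, but weakly up to \<open>U\<close>: keys tied
    with an end count as inside.\<close>
  define lo where "lo = (\<lambda>j k b. card {q. q < n k \<and> x k (e k q) < L j k (e j b)})"
  define hi where "hi = (\<lambda>j k b. card {q. q < n k \<and> x k (e k q) \<le> U j k (e j b)})"
  interpret ps: position_system r t n lo hi by unfold_locales (use r t in auto)
  have lo: "lo j k b \<le> p \<longleftrightarrow> L j k (e j b) \<le> x k (e k p)" if "k \<in> {1..r}" "p < n k" for j k b p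
  proof -
    have "p < lo j k b \<longleftrightarrow> p \<in> {q. q < n k \<and> x k (e k q) < L j k (e j b)}"
      unfolding lo_def
      by (rule initial_segment_eq) (auto simp: n_def intro: order_le_less_trans[OF mono[OF that(1)]])
    then show ?thesis using that by auto
  qed
  have hi: "p < hi j k b \<longleftrightarrow> x k (e k p) \<le> U j k (e j b)" if "k \<in> {1..r}" "p < n k" for j k b p
  proof -
    have "p < hi j k b \<longleftrightarrow> p \<in> {q. q < n k \<and> x k (e k q) \<le> U j k (e j b)}"
      unfolding hi_def
      by (rule initial_segment_eq) (auto simp: n_def intro: order_trans[OF mono[OF that(1)]])
    then show ?thesis using that by auto
  qed
  define \<Phi> where "\<Phi> = (\<lambda>u. \<lambda>j\<in>{1..r}. e j (u j))"
  have e_in: "e j p \<in> V j" if "j \<in> {1..r}" "p < n j" for j p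
    using e[OF that(1)] that(2) by (auto simp: bij_betw_def n_def)
  have iff: "u \<in> ps.edges \<longleftrightarrow> \<Phi> u \<in> H" if u: "u \<in> (\<Pi>\<^sub>E j\<in>{1..r}. {..<n j})" for u
  proof -
    have un: "u j < n j" if "j \<in> {1..r}" for j using u that by auto
    have "\<Phi> u \<in> (\<Pi>\<^sub>E j\<in>{1..r}. V j)" unfolding \<Phi>_def
      by (intro restrict_PiE_iff[THEN iffD2] ballI e_in un)
    then have "\<Phi> u \<in> H \<longleftrightarrow> (\<forall>j\<in>{1..r}. \<forall>k\<in>{1..r}. j \<noteq> k \<longrightarrow>
        L j k (e j (u j)) \<le> x k (e k (u k)) \<and> x k (e k (u k)) \<le> U j k (e j (u j)))"
      by (simp add: H_def) (simp add: \<Phi>_def)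
    also have "\<dots> \<longleftrightarrow> (\<forall>j\<in>{1..r}. \<forall>k\<in>{1..r}. j \<noteq> k \<longrightarrow> ps.inc j k (u j) (u k))"
      by (intro ball_cong refl) (simp add: ps.inc_def lo hi un)
    finally show ?thesis using u by (simp add: ps.edges_def)
  qed
  \<comment> \<open>Used for all positions to bound \<open>H\<close>, and for the sets
    \<open>T j\<close> to carry a complete subhypergraph back to \<open>H\<close>.\<close>
  have lift: "\<exists>u \<in> (\<Pi>\<^sub>E j\<in>{1..r}. S j). \<Phi> u = v" if "v \<in> (\<Pi>\<^sub>E j\<in>{1..r}. e j ` S j)" for v S
  proof -
    have "\<forall>j\<in>{1..r}. \<exists>p. p \<in> S j \<and> v j = e j p" using that by (auto simp: PiE_iff)
    then obtain u where u: "\<And>j. j \<in> {1..r} \<Longrightarrow> u j \<in> S j \<and> v j = e j (u j)" by metis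
    have "restrict u {1..r} \<in> (\<Pi>\<^sub>E j\<in>{1..r}. S j)" using u by (intro restrict_PiE_iff[THEN iffD2]) auto
    moreover have "\<Phi> (restrict u {1..r}) = v"
    proof (rule extensionalityI[of _ "{1..r}"])
      show "v \<in> extensional {1..r}" using that by (simp add: PiE_iff)
    qed (use u in \<open>auto simp: \<Phi>_def\<close>)
    ultimately show ?thesis by blast
  qed
  have V: "V j = e j ` {..<n j}" if "j \<in> {1..r}" for j
    using e[OF that] by (simp add: bij_betw_def n_def)
  have "H \<subseteq> \<Phi> ` ps.edges"
  proof
    fix v assume v: "v \<in> H"
    then have "v \<in> (\<Pi>\<^sub>E j\<in>{1..r}. e j ` {..<n j})"
      using V by (auto simp: H_def PiE_iff)
    from lift[OF this] v show "v \<in> \<Phi> ` ps.edges" using iff by blast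
  qed
  then have "card H \<le> card ps.edges" by (rule surj_card_le[OF ps.finite_edges])
  also have "\<dots> \<le> (r + 3 * r ^ 4) * t * (\<Sum>j\<in>{1..r}. ps.faces j)"
  proof (rule ps.card_edges, rule notI)
    assume "\<exists>T. (\<forall>j\<in>{1..r}. T j \<subseteq> {..<n j} \<and> card (T j) = t) \<and> (\<Pi>\<^sub>E j\<in>{1..r}. T j) \<subseteq> ps.edges"
    then obtain T where T: "\<And>j. j \<in> {1..r} \<Longrightarrow> T j \<subseteq> {..<n j}" "\<And>j. j \<in> {1..r} \<Longrightarrow> card (T j) = t"
      "(\<Pi>\<^sub>E j\<in>{1..r}. T j) \<subseteq> ps.edges" by metis
    have "e j ` T j \<subseteq> V j \<and> card (e j ` T j) = t" if j: "j \<in> {1..r}" for j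
    proof
      show "e j ` T j \<subseteq> V j" unfolding V[OF j] by (rule image_mono) (rule T(1)[OF j])
      have "inj_on (e j) (T j)"
        using e[OF j] T(1)[OF j] by (auto simp: bij_betw_def n_def intro: inj_on_subset)
      then show "card (e j ` T j) = t" using T(2)[OF j] by (simp add: card_image)
    qed
    moreover have "(\<Pi>\<^sub>E j\<in>{1..r}. e j ` T j) \<subseteq> H"
    proof
      fix v assume "v \<in> (\<Pi>\<^sub>E j\<in>{1..r}. e j ` T j)"
      from lift[OF this] obtain u where u: "u \<in> (\<Pi>\<^sub>E j\<in>{1..r}. T j)" "\<Phi> u = v" by blast
      then have "u \<in> ps.edges" using T(3) by blast
      moreover have "u \<in> (\<Pi>\<^sub>E j\<in>{1..r}. {..<n j})" using \<open>u \<in> ps.edges\<close> by (simp add: ps.edges_def)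
      ultimately show "v \<in> H" using iff u(2) by blast
    qed
    ultimately show False using free by (metis (no_types, lifting))
  qed
  finally show ?thesis by (simp only: ps.faces_def[unfolded n_def] n_def)
qed

section \<open>From coordinates to interval incidences\<close>

definition meeting :: "nat \<Rightarrow> (nat \<Rightarrow> 'a set) \<Rightarrow> ('a \<Rightarrow> nat \<Rightarrow> real) \<Rightarrow> ('a \<Rightarrow> nat \<Rightarrow> real) \<Rightarrow>
    nat set \<Rightarrow> (nat \<Rightarrow> 'a) set" where
  "meeting r V Lf Rg I = {v \<in> \<Pi>\<^sub>E j\<in>{1..r}. V j.
     \<forall>i\<in>I. \<exists>y. \<forall>j\<in>{1..r}. Lf (v j) i \<le> y \<and> y \<le> Rg (v j) i}"

definition K_free :: "nat \<Rightarrow> nat \<Rightarrow> (nat \<Rightarrow> 'a set) \<Rightarrow> (nat \<Rightarrow> 'a) set \<Rightarrow> bool" where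
  "K_free r t V H \<longleftrightarrow>
     (\<nexists>T. (\<forall>j\<in>{1..r}. T j \<subseteq> V j \<and> card (T j) = t) \<and> (\<Pi>\<^sub>E j\<in>{1..r}. T j) \<subseteq> H)"

text \<open>The product sets are pairwise disjoint by \<open>uniq\<close> and lie in the product of
  the \<open>V k\<close>. Single factors may overlap for different \<open>c\<close>.\<close>

lemma sum_prod_classes_le:
  fixes V :: "nat \<Rightarrow> 'a set" and Cls :: "'c \<Rightarrow> nat \<Rightarrow> 'a set"
  assumes J: "finite J" and fin: "\<And>k. k \<in> J \<Longrightarrow> finite (V k)" and K: "finite K"
    and sub: "\<And>c k. k \<in> J \<Longrightarrow> Cls c k \<subseteq> V k"
    and uniq: "\<And>c c' w. c \<in> K \<Longrightarrow> c' \<in> K \<Longrightarrow> w \<in> Pi J (Cls c) \<Longrightarrow> w \<in> Pi J (Cls c') \<Longrightarrow> c = c'"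
  shows "(\<Sum>c\<in>K. \<Prod>k\<in>J. card (Cls c k)) \<le> (\<Prod>k\<in>J. card (V k))"
proof -
  have "(\<Sum>c\<in>K. \<Prod>k\<in>J. card (Cls c k)) = (\<Sum>c\<in>K. card (Pi\<^sub>E J (Cls c)))"
    using J by (simp add: card_PiE)
  also have "\<dots> = card (\<Union>c\<in>K. Pi\<^sub>E J (Cls c))"
  proof (rule card_UN_disjoint[symmetric, OF K])
    show "\<forall>c\<in>K. finite (Pi\<^sub>E J (Cls c))"
      by (intro ballI finite_PiE J finite_subset[OF sub fin])
    show "\<forall>c\<in>K. \<forall>c'\<in>K. c \<noteq> c' \<longrightarrow> Pi\<^sub>E J (Cls c) \<inter> Pi\<^sub>E J (Cls c') = {}"
      using uniq by (auto simp: PiE_def)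
  qed
  also have "\<dots> \<le> card (Pi\<^sub>E J V)"
    by (intro card_mono finite_PiE J fin UN_least PiE_mono sub)
  also have "\<dots> = (\<Prod>k\<in>J. card (V k))" using J by (simp add: card_PiE)
  finally show ?thesis .
qed

text \<open>
  \<open>D\<close> collects the coordinates in which at least two classes are degenerate; there the values must
  coincide, so these coordinates only split the configuration into independent classes.
\<close>

lemma card_anchored_meeting:
  fixes V :: "nat \<Rightarrow> 'a set" and Lf Rg :: "'a \<Rightarrow> nat \<Rightarrow> real"
  assumes r: "1 \<le> r" and t: "1 \<le> t" and fin: "\<And>j. j \<in> {1..r} \<Longrightarrow> finite (V j)"
    and le: "\<And>j u i. j \<in> {1..r} \<Longrightarrow> u \<in> V j \<Longrightarrow> i \<in> D \<union> U \<Longrightarrow> Lf u i \<le> Rg u i"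
    and deg: "\<And>i j. i \<in> D \<Longrightarrow> j \<in> {1..r} \<Longrightarrow> \<exists>k\<in>{1..r} - {j}. \<forall>u\<in>V k. Lf u i = Rg u i"
    and inj: "inj_on \<phi> U" and \<phi>: "\<phi> ` U \<subseteq> {1..r}"
    and free: "K_free r t V (meeting r V Lf Rg (D \<union> U))"
  shows "card {v \<in> meeting r V Lf Rg (D \<union> U). \<forall>i\<in>U. \<forall>k\<in>{1..r}.
      Lf (v k) i \<le> Lf (v (\<phi> i)) i \<and> Lf (v (\<phi> i)) i \<le> Rg (v k) i}
    \<le> (r + 3 * r ^ 4) * t * (\<Sum>j\<in>{1..r}. \<Prod>k\<in>{1..r} - {j}. card (V k))" (is "card ?A \<le> _")
proof -
  define key where "key v = (\<lambda>i\<in>D. SOME y. \<forall>j\<in>{1..r}. Lf (v j) i \<le> y \<and> y \<le> Rg (v j) i)" for v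
  define Cls where "Cls c j = {u \<in> V j. \<forall>i\<in>D. Lf u i \<le> c i \<and> c i \<le> Rg u i}" for c j
  define \<psi> where "\<psi> = inv_into U \<phi>"
  have \<psi>: "\<psi> (\<phi> i) = i" if "i \<in> U" for i
    unfolding \<psi>_def by (rule inv_into_f_f[OF inj that])
  \<comment> \<open>Class \<open>\<phi> i\<close> supplies the point in coordinate \<open>i\<close>,
    namely its left end, and every other class an interval. For a class outside the image the
    constants \<open>0\<close> make the conditions void.\<close>
  define x where "x k u = (if k \<in> \<phi> ` U then Lf u (\<psi> k) else 0)" for k u
  define Up where "Up k u = (if k \<in> \<phi> ` U then Rg u (\<psi> k) else 0)" for k u
  define Hc where "Hc c = {v \<in> \<Pi>\<^sub>E j\<in>{1..r}. Cls c j. \<forall>j\<in>{1..r}. \<forall>k\<in>{1..r}. j \<noteq> k \<longrightarrow>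
    x k (v j) \<le> x k (v k) \<and> x k (v k) \<le> Up k (v j)}" for c
  have fA: "finite ?A"
    by (rule finite_subset[of _ "\<Pi>\<^sub>E j\<in>{1..r}. V j"]) (auto simp: meeting_def intro!: finite_PiE fin)
  have key: "\<forall>j\<in>{1..r}. Lf (v j) i \<le> key v i \<and> key v i \<le> Rg (v j) i" if "v \<in> ?A" "i \<in> D" for v i
  proof -
    have "\<exists>y. \<forall>j\<in>{1..r}. Lf (v j) i \<le> y \<and> y \<le> Rg (v j) i" using that by (auto simp: meeting_def)
    from someI_ex[OF this] show ?thesis using that(2) by (simp add: key_def)
  qed
  have sub: "?A \<subseteq> (\<Union>c\<in>key ` ?A. Hc c)"
  proof
    fix v assume v: "v \<in> ?A"
    then have "v \<in> (\<Pi>\<^sub>E j\<in>{1..r}. Cls (key v) j)"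
      using key[OF v] by (auto simp: meeting_def Cls_def PiE_iff)
    moreover have "x k (v j) \<le> x k (v k) \<and> x k (v k) \<le> Up k (v j)" if "j \<in> {1..r}" for j k
      using v that by (auto simp: x_def Up_def \<psi>)
    ultimately have "v \<in> Hc (key v)" by (simp add: Hc_def)
    then show "v \<in> (\<Union>c\<in>key ` ?A. Hc c)" using v by blast
  qed
  have Cls_sub: "Cls c j \<subseteq> V j" for c j by (auto simp: Cls_def)
  \<comment> \<open>Tuples in \<open>Hc c\<close> meet at \<open>c i\<close> for \<open>i\<close> in
    \<open>D\<close> and at the left end of class \<open>\<phi> i\<close> for \<open>i\<close> in
    \<open>U\<close>. Hence \<open>Hc c\<close> inherits freeness.\<close>
  have Hc_meet: "Hc c \<subseteq> meeting r V Lf Rg (D \<union> U)" for c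
  proof
    fix v assume v: "v \<in> Hc c"
    then have vc: "v \<in> (\<Pi>\<^sub>E j\<in>{1..r}. Cls c j)" by (simp add: Hc_def)
    then have vV: "v \<in> (\<Pi>\<^sub>E j\<in>{1..r}. V j)" using Cls_sub by (auto simp: PiE_iff)
    have "\<exists>y. \<forall>j\<in>{1..r}. Lf (v j) i \<le> y \<and> y \<le> Rg (v j) i" if "i \<in> D \<union> U" for i
    proof (cases "i \<in> D")
      case True
      then show ?thesis using vc by (intro exI[of _ "c i"]) (auto simp: Cls_def PiE_iff)
    next
      case False
      then have i: "i \<in> U" using that by simp
      have "Lf (v j) i \<le> Lf (v (\<phi> i)) i \<and> Lf (v (\<phi> i)) i \<le> Rg (v j) i" if j: "j \<in> {1..r}" for j
      proof (cases "j = \<phi> i")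
        case True
        then show ?thesis using le[OF j, of "v j" i] vV j i by (auto simp: PiE_iff)
      next
        case False
        have "\<phi> i \<in> {1..r}" using \<phi> i by blast
        then have "x (\<phi> i) (v j) \<le> x (\<phi> i) (v (\<phi> i)) \<and> x (\<phi> i) (v (\<phi> i)) \<le> Up (\<phi> i) (v j)"
          using v j False by (simp add: Hc_def)
        then show ?thesis using i by (simp add: x_def Up_def \<psi>)
      qed
      then show ?thesis by blast
    qed
    then show "v \<in> meeting r V Lf Rg (D \<union> U)" using vV by (simp add: meeting_def)
  qed
  have Hc_card: "card (Hc c) \<le> (r + 3 * r ^ 4) * t * (\<Sum>j\<in>{1..r}. \<Prod>k\<in>{1..r} - {j}. card (Cls c k))" for c
    unfolding Hc_def
  proof (rule card_keyed_incidences[OF r t])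
    show "finite (Cls c j)" if "j \<in> {1..r}" for j using fin[OF that] Cls_sub by (rule rev_finite_subset)
    show "\<nexists>T. (\<forall>j\<in>{1..r}. T j \<subseteq> Cls c j \<and> card (T j) = t) \<and> (\<Pi>\<^sub>E j\<in>{1..r}. T j)
        \<subseteq> {v \<in> \<Pi>\<^sub>E j\<in>{1..r}. Cls c j. \<forall>j\<in>{1..r}. \<forall>k\<in>{1..r}. j \<noteq> k \<longrightarrow>
          x k (v j) \<le> x k (v k) \<and> x k (v k) \<le> Up k (v j)}"
      unfolding Hc_def[symmetric]
    proof (rule notI, elim exE conjE)
      fix T assume T: "\<forall>j\<in>{1..r}. T j \<subseteq> Cls c j \<and> card (T j) = t" "(\<Pi>\<^sub>E j\<in>{1..r}. T j) \<subseteq> Hc c"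
      have "\<forall>j\<in>{1..r}. T j \<subseteq> V j \<and> card (T j) = t" using T(1) Cls_sub by blast
      then show False using free T(2) Hc_meet[of c] unfolding K_free_def by (meson order_trans)
    qed
  qed
  have "card ?A \<le> card (\<Union>c\<in>key ` ?A. Hc c)"
  proof (rule card_mono[OF _ sub])
    have "finite (\<Pi>\<^sub>E j\<in>{1..r}. V j)" by (intro finite_PiE fin) auto
    moreover have "Hc c \<subseteq> (\<Pi>\<^sub>E j\<in>{1..r}. V j)" for c using Hc_meet[of c] by (auto simp: meeting_def)
    ultimately have "finite (Hc c)" for c by (blast intro: finite_subset)
    then show "finite (\<Union>c\<in>key ` ?A. Hc c)" using fA by blast
  qed
  also have "\<dots> \<le> (\<Sum>c\<in>key ` ?A. card (Hc c))" by (rule card_UN_le) (use fA in blast)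
  also have "\<dots> \<le> (\<Sum>c\<in>key ` ?A. (r + 3 * r ^ 4) * t * (\<Sum>j\<in>{1..r}. \<Prod>k\<in>{1..r} - {j}. card (Cls c k)))"
    by (rule sum_mono) (rule Hc_card)
  also have "\<dots> = (r + 3 * r ^ 4) * t * (\<Sum>j\<in>{1..r}. \<Sum>c\<in>key ` ?A. \<Prod>k\<in>{1..r} - {j}. card (Cls c k))"
    by (simp only: sum_distrib_left[symmetric] sum.swap[of _ "{1..r}"])
  also have "\<dots> \<le> (r + 3 * r ^ 4) * t * (\<Sum>j\<in>{1..r}. \<Prod>k\<in>{1..r} - {j}. card (V k))"
  proof (intro mult_left_mono sum_mono)
    fix j assume j: "j \<in> {1..r}"
    show "(\<Sum>c\<in>key ` ?A. \<Prod>k\<in>{1..r} - {j}. card (Cls c k)) \<le> (\<Prod>k\<in>{1..r} - {j}. card (V k))"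
    proof (rule sum_prod_classes_le)
      fix c c' w assume c: "c \<in> key ` ?A" "c' \<in> key ` ?A"
        and w: "w \<in> Pi ({1..r} - {j}) (Cls c)" "w \<in> Pi ({1..r} - {j}) (Cls c')"
      show "c = c'"
      proof (rule extensionalityI[of _ D])
        show "c \<in> extensional D" "c' \<in> extensional D" using c by (auto simp: key_def)
        fix i assume i: "i \<in> D"
        \<comment> \<open>Even with class \<open>j\<close> left out, a degenerate class
          \<open>k\<close> remains, and its member determines the value at \<open>i\<close>.\<close>
        obtain k where k: "k \<in> {1..r} - {j}" "\<And>u. u \<in> V k \<Longrightarrow> Lf u i = Rg u i" using deg[OF i j] by blast
        have "w k \<in> Cls c k" "w k \<in> Cls c' k" using w k(1) by auto
        then have "Lf (w k) i \<le> c i" "c i \<le> Rg (w k) i" "Lf (w k) i \<le> c' i" "c' i \<le> Rg (w k) i"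
          "Lf (w k) i = Rg (w k) i" using i k(2) by (auto simp: Cls_def)
        then show "c i = c' i" by linarith
      qed
    qed (use fin fA Cls_sub in auto)
  qed auto
  finally show ?thesis .
qed

text \<open>A coordinate outside \<open>D\<close> lies in \<open>F j\<close> for all
  \<open>j\<close> other than \<open>\<phi> s i\<close>. Two coordinates with the same
  \<open>\<phi>\<close>-value would lie in a common intersection of \<open>r - 1\<close> direction
  sets, so non-2-coherence makes \<open>\<phi> s\<close> injective. Summing over \<open>s\<close>
  costs a factor \<open>r\<close>.\<close>

lemma card_meeting:
  fixes V :: "nat \<Rightarrow> 'a set" and Lf Rg :: "'a \<Rightarrow> nat \<Rightarrow> real"
  assumes r: "2 \<le> r" and t: "1 \<le> t" and fin: "\<And>j. j \<in> {1..r} \<Longrightarrow> finite (V j)"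
    and le: "\<And>j u i. j \<in> {1..r} \<Longrightarrow> u \<in> V j \<Longrightarrow> i \<in> I \<Longrightarrow> Lf u i \<le> Rg u i"
    and dir: "\<And>j u i. j \<in> {1..r} \<Longrightarrow> u \<in> V j \<Longrightarrow> i \<in> I \<Longrightarrow> i \<notin> F j \<Longrightarrow> Lf u i = Rg u i"
    and I: "finite I" and F: "\<And>j. j \<in> {1..r} \<Longrightarrow> F j \<subseteq> I"
    and coh: "non_2_coherent r F"
    and free: "K_free r t V (meeting r V Lf Rg I)"
  shows "card (meeting r V Lf Rg I)
    \<le> r * ((r + 3 * r ^ 4) * t * (\<Sum>j\<in>{1..r}. \<Prod>k\<in>{1..r} - {j}. card (V k)))"
proof -
  have card_r: "{1..r} - {k} \<noteq> {}" for k
  proof -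
    have "(if k = 1 then 2 else 1) \<in> {1..r} - {k}" using r by auto
    then show ?thesis by blast
  qed
  have eqI: "i = i'" if k: "k \<in> {1..r}" and i: "\<And>j. j \<in> {1..r} - {k} \<Longrightarrow> i \<in> F j \<and> i' \<in> F j" for k i i'
  proof -
    let ?S = "\<Inter>j\<in>{1..r} - {k}. F j"
    \<comment> \<open>The index set is nonempty, so the intersection is finite. For an infinite set
      \<open>card\<close> would be \<open>0\<close> and the bound empty.\<close>
    obtain j where "j \<in> {1..r} - {k}" using card_r by blast
    then have "?S \<subseteq> I" using F by blast
    then have fS: "finite ?S" using I by (rule finite_subset)
    have "card ?S \<le> Suc 0" using coh k by (simp add: non_2_coherent_def)
    then have "\<forall>a\<in>?S. \<forall>b\<in>?S. a = b" by (rule card_le_Suc0_iff_eq[OF fS, THEN iffD1])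
    moreover have "i \<in> ?S" "i' \<in> ?S" using i by blast+
    ultimately show ?thesis by blast
  qed
  define D where "D = {i \<in> I. \<exists>j\<in>{1..r}. \<exists>k\<in>{1..r}. j \<noteq> k \<and> i \<notin> F j \<and> i \<notin> F k}"
  define U where "U = I - D"
  have DU: "D \<union> U = I" by (auto simp: D_def U_def)
  \<comment> \<open>By non-2-coherence at most one coordinate has no degenerate class at all. There the intervals
    meet iff all of them contain the largest left end, and \<open>s\<close> guesses the class attaining it.\<close>
  define \<phi> where "\<phi> s i = (if \<exists>j\<in>{1..r}. i \<notin> F j then SOME j. j \<in> {1..r} \<and> i \<notin> F j else s)"
    for s i :: nat
  have missing: "\<phi> s i \<in> {1..r} \<and> i \<notin> F (\<phi> s i)" if "\<exists>j\<in>{1..r}. i \<notin> F j" for s i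
  proof -
    have "\<exists>j. j \<in> {1..r} \<and> i \<notin> F j" using that by blast
    from someI_ex[OF this] show ?thesis unfolding \<phi>_def if_P[OF that] .
  qed
  have full: "\<phi> s i = s" if "\<And>j. j \<in> {1..r} \<Longrightarrow> i \<in> F j" for s i
    using that by (auto simp: \<phi>_def)
  have \<phi>_r: "\<phi> s i \<in> {1..r}" if "s \<in> {1..r}" for s i
    using missing[of i s] full[of i s] that by metis
  have \<phi>_F: "i \<in> F j" if "i \<in> U" "j \<in> {1..r}" "j \<noteq> \<phi> s i" for i j s
  proof (rule ccontr)
    assume "i \<notin> F j"
    then have "\<phi> s i \<in> {1..r} \<and> i \<notin> F (\<phi> s i)" using missing that(2) by blast
    moreover have "i \<in> I" "i \<notin> D" using that(1) by (auto simp: U_def)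
    ultimately show False using that(2,3) \<open>i \<notin> F j\<close> unfolding D_def by blast
  qed
  let ?H = "meeting r V Lf Rg I"
  let ?A = "\<lambda>s. {v \<in> ?H. \<forall>i\<in>U. \<forall>k\<in>{1..r}.
      Lf (v k) i \<le> Lf (v (\<phi> s i)) i \<and> Lf (v (\<phi> s i)) i \<le> Rg (v k) i}"
  have card_A: "card (?A s) \<le> (r + 3 * r ^ 4) * t * (\<Sum>j\<in>{1..r}. \<Prod>k\<in>{1..r} - {j}. card (V k))"
    if s: "s \<in> {1..r}" for s
  proof -
    have "inj_on (\<phi> s) U"
    proof (rule inj_onI)
      fix i i' assume i: "i \<in> U" "i' \<in> U" "\<phi> s i = \<phi> s i'"
      show "i = i'"
        by (rule eqI[OF \<phi>_r[OF s, of i]]) (use \<phi>_F[OF i(1), of _ s] \<phi>_F[OF i(2), of _ s] i(3) in auto)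
    qed
    moreover have "\<phi> s ` U \<subseteq> {1..r}" using \<phi>_r[OF s] by blast
    moreover have "\<exists>k\<in>{1..r} - {j}. \<forall>u\<in>V k. Lf u i = Rg u i" if i: "i \<in> D" for i j
    proof -
      obtain k k' where k: "k \<in> {1..r}" "k' \<in> {1..r}" "k \<noteq> k'" "i \<notin> F k" "i \<notin> F k'" "i \<in> I"
        using i by (auto simp: D_def)
      then show ?thesis using dir[of k] dir[of k'] by (metis DiffI singletonD)
    qed
    ultimately show ?thesis
      using card_anchored_meeting[of r t V D U Lf Rg "\<phi> s"] r t fin le free unfolding DU by simp
  qed
  have "?H \<subseteq> (\<Union>s\<in>{1..r}. ?A s)"
  proof
    fix v assume v: "v \<in> ?H"
    have vV: "v j \<in> V j" if "j \<in> {1..r}" for j using v that by (auto simp: meeting_def)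
    have meet: "Lf (v j) i \<le> Rg (v k) i" if "i \<in> I" "j \<in> {1..r}" "k \<in> {1..r}" for i j k
    proof -
      have "\<exists>y. \<forall>j\<in>{1..r}. Lf (v j) i \<le> y \<and> y \<le> Rg (v j) i" using v that(1) by (simp add: meeting_def)
      then obtain y where "\<And>j. j \<in> {1..r} \<Longrightarrow> Lf (v j) i \<le> y \<and> y \<le> Rg (v j) i" by blast
      then show ?thesis using that(2,3) by (blast intro: order_trans)
    qed
    have ex: "\<exists>s\<in>{1..r}. \<forall>j\<in>{1..r}. Lf (v j) i \<le> Lf (v s) i" for i
    proof -
      have "Max ((\<lambda>j. Lf (v j) i) ` {1..r}) \<in> (\<lambda>j. Lf (v j) i) ` {1..r}"
        by (rule Max_in) (use r in auto)
      then obtain s where s: "s \<in> {1..r}" "Max ((\<lambda>j. Lf (v j) i) ` {1..r}) = Lf (v s) i" by auto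
      then have "Lf (v j) i \<le> Lf (v s) i" if "j \<in> {1..r}" for j
        using that by (simp flip: s(2))
      then show ?thesis using s(1) by blast
    qed
    define Z where "Z i \<longleftrightarrow> (\<forall>j\<in>{1..r}. i \<in> F j)" for i
    \<comment> \<open>At most one coordinate satisfies \<open>Z\<close>; \<open>s\<close> is a class
      with the largest left end there. Without such a coordinate any class will do, say
      \<open>1\<close>.\<close>
    obtain s where s: "s \<in> {1..r}" "\<And>i j. i \<in> U \<Longrightarrow> Z i \<Longrightarrow> j \<in> {1..r} \<Longrightarrow> Lf (v j) i \<le> Lf (v s) i"
    proof (cases "\<exists>i0. Z i0")
      case True
      then obtain i0 where i0: "Z i0" by blast
      obtain s where s: "s \<in> {1..r}" "\<And>j. j \<in> {1..r} \<Longrightarrow> Lf (v j) i0 \<le> Lf (v s) i0" using ex by blast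
      have "i = i0" if "Z i" for i
        by (rule eqI[OF s(1)]) (use that i0 in \<open>auto simp: Z_def\<close>)
      then show ?thesis using that s by blast
    next
      case False
      then show ?thesis using that[of 1] r by auto
    qed
    have "v \<in> ?A s"
    proof (intro CollectI conjI ballI v)
      fix i k assume i: "i \<in> U" and k: "k \<in> {1..r}"
      have iI: "i \<in> I" using i by (simp add: U_def)
      show "Lf (v (\<phi> s i)) i \<le> Rg (v k) i" by (rule meet[OF iI \<phi>_r[OF s(1)] k])
      show "Lf (v k) i \<le> Lf (v (\<phi> s i)) i"
      proof (cases "Z i")
        case True
        then show ?thesis using s(2)[OF i True k] full[of i s] by (simp add: Z_def)
      next
        case False
        then have m: "\<phi> s i \<in> {1..r}" "i \<notin> F (\<phi> s i)" using missing by (auto simp: Z_def)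
        \<comment> \<open>A degenerate interval has equal ends, so meeting it bounds the other left
          ends by its own.\<close>
        then show ?thesis using meet[OF iI k m(1)] dir[OF m(1) vV[OF m(1)] iI m(2)] by simp
      qed
    qed
    then show "v \<in> (\<Union>s\<in>{1..r}. ?A s)" using s(1) by blast
  qed
  moreover have "finite ?H"
    by (rule finite_subset[of _ "\<Pi>\<^sub>E j\<in>{1..r}. V j"]) (auto simp: meeting_def intro!: finite_PiE fin)
  ultimately have "card ?H \<le> card (\<Union>s\<in>{1..r}. ?A s)" by (intro card_mono) auto
  also have "\<dots> \<le> (\<Sum>s\<in>{1..r}. card (?A s))" by (rule card_UN_le) simp
  also have "\<dots> \<le> (\<Sum>s\<in>{1..r}. (r + 3 * r ^ 4) * t * (\<Sum>j\<in>{1..r}. \<Prod>k\<in>{1..r} - {j}. card (V k)))"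
    by (rule sum_mono) (rule card_A)
  finally show ?thesis by simp
qed

section \<open>Boxes\<close>

lemma vertices_eq:
  "vertices \<B> j = (\<lambda>(X, c). (j, X, c)) ` (SIGMA X:set_mset (\<B> j). {..<count (\<B> j) X})"
  by (force simp: vertices_def intro: count_inI)

lemma finite_vertices: "finite (vertices \<B> j)"
  unfolding vertices_eq by (intro finite_imageI finite_SigmaI) auto

lemma card_vertices: "card (vertices \<B> j) = size (\<B> j)"
proof -
  have "card (vertices \<B> j) = card (SIGMA X:set_mset (\<B> j). {..<count (\<B> j) X})"
    unfolding vertices_eq by (rule card_image) (auto simp: inj_on_def)
  then show ?thesis by (simp add: size_multiset_overloaded_eq)
qed

text \<open>The ends hidden in \<open>is_box\<close> become arguments, so that they can be chosen as
  functions of the vertex.\<close>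

definition box_ends ::
  "nat \<Rightarrow> nat set \<Rightarrow> point set \<Rightarrow> (nat \<Rightarrow> real) \<Rightarrow> (nat \<Rightarrow> real) \<Rightarrow> bool" where
  "box_ends d D X a b \<longleftrightarrow> (\<forall>i\<in>{1..d}. a i \<le> b i) \<and> X = (\<Pi>\<^sub>E i\<in>{1..d}. {a i..b i}) \<and>
     D = {i \<in> {1..d}. a i < b i}"

lemma ex_box_ends:
  assumes "F_family d r F \<B>"
  shows "\<exists>Lf Rg. \<forall>j\<in>{1..r}. \<forall>u\<in>vertices \<B> j. box_ends d (F j) (box_of u) (Lf u) (Rg u)"
proof -
  have box: "\<exists>a b. box_ends d (F (fst u)) (box_of u) a b" if uj: "u \<in> vertices \<B> j" "j \<in> {1..r}" for u j
  proof -
    obtain X c where u: "u = (j, X, c)" "c < count (\<B> j) X" using uj(1) by (auto simp: vertices_def)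
    have "X \<in># \<B> j" by (rule count_inI) (use u(2) in simp)
    then have "is_box d (F j) X" using assms uj(2) by (simp add: F_family_def)
    then show ?thesis unfolding is_box_def box_ends_def by (simp add: u(1) box_of_def)
  qed
  define Lf where "Lf u = (SOME a. \<exists>b. box_ends d (F (fst u)) (box_of u) a b)" for u
  define Rg where "Rg u = (SOME b. box_ends d (F (fst u)) (box_of u) (Lf u) b)" for u
  have "box_ends d (F j) (box_of u) (Lf u) (Rg u)" if u: "u \<in> vertices \<B> j" "j \<in> {1..r}" for u j
  proof -
    have "\<exists>b. box_ends d (F (fst u)) (box_of u) (Lf u) b"
      unfolding Lf_def by (rule someI_ex[OF box[OF u]])
    then have "box_ends d (F (fst u)) (box_of u) (Lf u) (Rg u)"
      unfolding Rg_def by (rule someI_ex)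
    moreover have "fst u = j" using u(1) by (auto simp: vertices_def)
    ultimately show ?thesis by simp
  qed
  then show ?thesis by blast
qed

lemma Inter_boxes_nonempty_iff:
  fixes a b :: "nat \<Rightarrow> nat \<Rightarrow> real"
  assumes "1 \<le> r" "\<And>j. j \<in> {1..r} \<Longrightarrow> X j = (\<Pi>\<^sub>E i\<in>I. {a j i..b j i})"
  shows "(\<Inter>j\<in>{1..r}. X j) \<noteq> {} \<longleftrightarrow> (\<forall>i\<in>I. \<exists>y. \<forall>j\<in>{1..r}. a j i \<le> y \<and> y \<le> b j i)"
proof
  assume "(\<Inter>j\<in>{1..r}. X j) \<noteq> {}"
  then obtain p where "\<And>j. j \<in> {1..r} \<Longrightarrow> p \<in> (\<Pi>\<^sub>E i\<in>I. {a j i..b j i})"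
    using assms(2) by blast
  then have "a j i \<le> p i \<and> p i \<le> b j i" if "i \<in> I" "j \<in> {1..r}" for i j
    using that by (auto simp: PiE_iff)
  then show "\<forall>i\<in>I. \<exists>y. \<forall>j\<in>{1..r}. a j i \<le> y \<and> y \<le> b j i" by blast
next
  assume "\<forall>i\<in>I. \<exists>y. \<forall>j\<in>{1..r}. a j i \<le> y \<and> y \<le> b j i"
  then obtain p where "\<And>i. i \<in> I \<Longrightarrow> \<forall>j\<in>{1..r}. a j i \<le> p i \<and> p i \<le> b j i" by metis
  then have "restrict p I \<in> X j" if "j \<in> {1..r}" for j
    using that assms(2)[OF that] by (simp add: PiE_iff)
  then show "(\<Inter>j\<in>{1..r}. X j) \<noteq> {}" by blast
qed

text \<open>Every hyperedge is the image of an extensional tuple, so counting tuples suffices.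
  Restricting transversals to \<open>{1..r}\<close> translates freeness.\<close>

lemma card_hyperedges:
  assumes r: "2 \<le> r" and t: "1 \<le> t" and F: "direction_vector d r F" and coh: "non_2_coherent r F"
    and fam: "F_family d r F \<B>" and free: "\<not> contains_K r t \<B>"
  shows "card (hyperedges r \<B>)
    \<le> r * ((r + 3 * r ^ 4) * t * (\<Sum>j\<in>{1..r}. \<Prod>k\<in>{1..r} - {j}. size (\<B> k)))"
proof -
  obtain Lf Rg where
    "\<And>j u. j \<in> {1..r} \<Longrightarrow> u \<in> vertices \<B> j \<Longrightarrow> box_ends d (F j) (box_of u) (Lf u) (Rg u)"
    using ex_box_ends[OF fam] by blast
  note ends = this[unfolded box_ends_def]
  let ?M = "meeting r (vertices \<B>) Lf Rg {1..d}"
  have M: "restrict v {1..r} \<in> ?M \<longleftrightarrow> (\<Inter>j\<in>{1..r}. box_of (v j)) \<noteq> {}"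
    if "\<And>j. j \<in> {1..r} \<Longrightarrow> v j \<in> vertices \<B> j" for v
  proof -
    have "(\<Inter>j\<in>{1..r}. box_of (v j)) \<noteq> {} \<longleftrightarrow>
        (\<forall>i\<in>{1..d}. \<exists>y. \<forall>j\<in>{1..r}. Lf (v j) i \<le> y \<and> y \<le> Rg (v j) i)"
      by (rule Inter_boxes_nonempty_iff) (use r ends that in auto)
    moreover have "restrict v {1..r} \<in> (\<Pi>\<^sub>E j\<in>{1..r}. vertices \<B> j)"
      using that by (intro restrict_PiE_iff[THEN iffD2]) auto
    ultimately show ?thesis by (simp add: meeting_def)
  qed
  have fM: "finite ?M"
    by (rule finite_subset[of _ "\<Pi>\<^sub>E j\<in>{1..r}. vertices \<B> j"])
      (auto simp: meeting_def intro!: finite_PiE finite_vertices)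
  have "hyperedges r \<B> \<subseteq> (\<lambda>v. v ` {1..r}) ` ?M"
  proof
    fix h assume "h \<in> hyperedges r \<B>"
    then obtain v where v: "h = v ` {1..r}" "\<And>j. j \<in> {1..r} \<Longrightarrow> v j \<in> vertices \<B> j"
      "(\<Inter>j\<in>{1..r}. box_of (v j)) \<noteq> {}"
      unfolding hyperedges_def by blast
    then have "restrict v {1..r} \<in> ?M" using M[OF v(2)] by blast
    moreover have "h = restrict v {1..r} ` {1..r}" using v(1) by simp
    ultimately show "h \<in> (\<lambda>v. v ` {1..r}) ` ?M" by blast
  qed
  then have "card (hyperedges r \<B>) \<le> card ?M" by (rule surj_card_le[OF fM])
  also have "\<dots> \<le> r * ((r + 3 * r ^ 4) * t * (\<Sum>j\<in>{1..r}. \<Prod>k\<in>{1..r} - {j}. card (vertices \<B> k)))"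
  proof (rule card_meeting[OF r t finite_vertices _ _ _ _ coh])
    show "Lf u i \<le> Rg u i" if "j \<in> {1..r}" "u \<in> vertices \<B> j" "i \<in> {1..d}" for j u i
      using ends[OF that(1,2)] that(3) by blast
    show "Lf u i = Rg u i" if "j \<in> {1..r}" "u \<in> vertices \<B> j" "i \<in> {1..d}" "i \<notin> F j" for j u i
      using ends[OF that(1,2)] that(3,4) by force
    show "F j \<subseteq> {1..d}" if "j \<in> {1..r}" for j using F that by (simp add: direction_vector_def)
    show "K_free r t (vertices \<B>) ?M"
      unfolding K_free_def
    proof (rule notI, elim exE conjE)
      fix T assume T: "\<forall>j\<in>{1..r}. T j \<subseteq> vertices \<B> j \<and> card (T j) = t"
        and TM: "(\<Pi>\<^sub>E j\<in>{1..r}. T j) \<subseteq> ?M"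
      have "v ` {1..r} \<in> hyperedges r \<B>" if v: "\<forall>j\<in>{1..r}. v j \<in> T j" for v
      proof -
        have vj: "v j \<in> vertices \<B> j" if "j \<in> {1..r}" for j using v T that by blast
        have "restrict v {1..r} \<in> (\<Pi>\<^sub>E j\<in>{1..r}. T j)"
          using v by (intro restrict_PiE_iff[THEN iffD2]) auto
        then have "(\<Inter>j\<in>{1..r}. box_of (v j)) \<noteq> {}" using TM M[OF vj] by blast
        then show ?thesis using vj unfolding hyperedges_def by blast
      qed
      then show False using free T unfolding contains_K_def by blast
    qed
  qed simp
  finally show ?thesis by (simp only: card_vertices)
qed

text \<open>Makes the set under \<open>Max\<close> in \<open>zar\<close> nonempty. Boxes of class
  \<open>1\<close> start at \<open>0\<close>, all others at \<open>5\<close>, with side lengths at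
  most \<open>1\<close>, so coordinate \<open>1\<close> separates classes \<open>1\<close> and
  \<open>2\<close>.\<close>

lemma ex_edgeless_family:
  assumes "1 \<le> d" "2 \<le> r" "direction_vector d r F"
  shows "\<exists>\<B>. F_family d r F \<B> \<and> (\<forall>j\<in>{1..r}. size (\<B> j) = n j) \<and> hyperedges r \<B> = {}"
proof -
  define a :: "nat \<Rightarrow> nat \<Rightarrow> real" where "a j i = (if j = 1 then 0 else 5)" for j i
  define b where "b j i = a j i + (if i \<in> F j then 1 else 0)" for j i
  define X where "X j = (\<Pi>\<^sub>E i\<in>{1..d}. {a j i..b j i})" for j
  define \<B> where "\<B> j = replicate_mset (n j) (X j)" for j
  have "is_box d (F j) (X j)" if "j \<in> {1..r}" for j
    unfolding is_box_def
  proof (rule exI[of _ "a j"], rule exI[of _ "b j"], intro conjI)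
    show "F j = {i \<in> {1..d}. a j i < b j i}"
      using assms(3)[unfolded direction_vector_def, rule_format, OF that] by (auto simp: b_def)
  qed (auto simp: X_def b_def)
  then have "F_family d r F \<B>" by (auto simp: F_family_def \<B>_def)
  moreover have "hyperedges r \<B> = {}"
  proof (rule ccontr)
    assume "hyperedges r \<B> \<noteq> {}"
    then obtain v where v: "\<And>j. j \<in> {1..r} \<Longrightarrow> v j \<in> vertices \<B> j"
      and "(\<Inter>j\<in>{1..r}. box_of (v j)) \<noteq> {}" unfolding hyperedges_def by blast
    then obtain p where p: "\<And>j. j \<in> {1..r} \<Longrightarrow> p \<in> box_of (v j)" by blast
    have "box_of (v j) = X j" if "j \<in> {1..r}" for j
      using v[OF that] by (auto simp: vertices_def box_of_def \<B>_def split: if_splits)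
    then have "p \<in> X 1" "p \<in> X 2" using p assms(2) by (metis atLeastAtMost_iff le_refl one_le_numeral order_trans)+
    then have "p 1 \<in> {a 1 1..b 1 1}" "p 1 \<in> {a 2 1..b 2 1}" using assms(1) by (auto simp: X_def PiE_iff)
    then show False by (auto simp: a_def b_def split: if_splits)
  qed
  ultimately show ?thesis by (intro exI[of _ \<B>]) (simp add: \<B>_def)
qed

section \<open>Bounding the extremal function\<close>

lemma g_fun_eq:
  assumes "\<forall>j\<in>{1..r}. 1 \<le> n j"
  shows "g_fun r t n = real (t * (\<Sum>j\<in>{1..r}. \<Prod>k\<in>{1..r} - {j}. n k))"
proof -
  have "(\<Prod>k\<in>{1..r}. real (n k)) * (1 / real (n j)) = (\<Prod>k\<in>{1..r} - {j}. real (n k))"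
    if "j \<in> {1..r}" for j
  proof -
    have "1 \<le> n j" using assms that by blast
    then show ?thesis by (subst prod.remove[OF _ that]) simp_all
  qed
  then have "(\<Prod>k\<in>{1..r}. real (n k)) * (\<Sum>j\<in>{1..r}. 1 / real (n j))
      = (\<Sum>j\<in>{1..r}. \<Prod>k\<in>{1..r} - {j}. real (n k))"
    unfolding sum_distrib_left by (rule sum.cong[OF refl])
  then show ?thesis by (simp add: g_fun_def mult.assoc)
qed

theorem theorem3p1:
  fixes r :: nat
  assumes "r \<ge> 2"
  shows "\<exists>\<Lambda>::real. \<Lambda> > 0 \<and>
    (\<forall>(d::nat) (t::nat) (F :: nat \<Rightarrow> nat set) (n :: nat \<Rightarrow> nat).
       d \<ge> 1 \<longrightarrow> t \<ge> 2 \<longrightarrow> direction_vector d r F \<longrightarrow> non_2_coherent r F \<longrightarrow>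
       (\<forall>j\<in>{1..r}. n j \<ge> 1) \<longrightarrow>
       real (zar d r F n t) \<le> \<Lambda> * g_fun r t n)"
proof (intro exI[of _ "real (r * (r + 3 * r ^ 4))"] conjI allI impI)
  \<comment> \<open>The outer factor \<open>r\<close> comes from the guess \<open>s\<close> in
    \<open>card_meeting\<close>, the inner one from \<open>card_edges\<close>.\<close>
  have "0 < r * (r + 3 * r ^ 4)" using assms by simp
  then show "0 < real (r * (r + 3 * r ^ 4))" by (rule of_nat_0_less_iff[THEN iffD2])
next
  fix d t :: nat and F :: "nat \<Rightarrow> nat set" and n :: "nat \<Rightarrow> nat"
  assume d: "1 \<le> d" and t: "2 \<le> t" and F: "direction_vector d r F" "non_2_coherent r F"
    and n: "\<forall>j\<in>{1..r}. 1 \<le> n j"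
  let ?Z = "{card (hyperedges r \<B>) | \<B>.
    F_family d r F \<B> \<and> (\<forall>j\<in>{1..r}. size (\<B> j) = n j) \<and> \<not> contains_K r t \<B>}"
  let ?G = "r * ((r + 3 * r ^ 4) * t * (\<Sum>j\<in>{1..r}. \<Prod>k\<in>{1..r} - {j}. n k))"
  \<comment> \<open>This bound on the members gives finiteness of \<open>?Z\<close> as well as the
    bound on its maximum.\<close>
  have le: "z \<le> ?G" if z: "z \<in> ?Z" for z
  proof -
    obtain \<B> where \<B>: "z = card (hyperedges r \<B>)" "F_family d r F \<B>" "\<not> contains_K r t \<B>"
      and size: "\<And>j. j \<in> {1..r} \<Longrightarrow> size (\<B> j) = n j" using z by blast
    have "(\<Sum>j\<in>{1..r}. \<Prod>k\<in>{1..r} - {j}. size (\<B> k)) = (\<Sum>j\<in>{1..r}. \<Prod>k\<in>{1..r} - {j}. n k)"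
      by (intro sum.cong prod.cong refl size) auto
    then show ?thesis
      using card_hyperedges[OF assms _ F \<B>(2,3)] t \<B>(1) by simp
  qed
  obtain \<B> where \<B>: "F_family d r F \<B>" "\<forall>j\<in>{1..r}. size (\<B> j) = n j" "hyperedges r \<B> = {}"
    using ex_edgeless_family[OF d assms F(1)] by blast
  have "\<not> contains_K r t \<B>"
  proof
    assume "contains_K r t \<B>"
    then obtain S where S: "\<And>j. j \<in> {1..r} \<Longrightarrow> card (S j) = t"
      "\<And>v. (\<forall>j\<in>{1..r}. v j \<in> S j) \<Longrightarrow> v ` {1..r} \<in> hyperedges r \<B>"
      unfolding contains_K_def by metis
    have "S j \<noteq> {}" if "j \<in> {1..r}" for j using S(1)[OF that] t by auto
    then have "\<forall>j\<in>{1..r}. (SOME x. x \<in> S j) \<in> S j" by (simp add: some_in_eq)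
    then show False using S(2)[of "\<lambda>j. SOME x. x \<in> S j"] \<B>(3) by blast
  qed
  then have ne: "?Z \<noteq> {}" using \<B> by blast
  have fin: "finite ?Z" using le by (intro finite_subset[of ?Z "{..?G}"]) auto
  have "zar d r F n t \<le> ?G" unfolding zar_def by (rule le, rule Max_in[OF fin ne])
  then have "real (zar d r F n t) \<le> real ?G" by (rule of_nat_mono)
  also have "\<dots> = real (r * (r + 3 * r ^ 4)) * g_fun r t n"
    unfolding g_fun_eq[OF n] by (simp only: of_nat_mult mult.assoc)
  finally show "real (zar d r F n t) \<le> real (r * (r + 3 * r ^ 4)) * g_fun r t n" .
qed

end
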